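(* Let a grid $[1,r]\times[1,r]$ store $r$ points, each with an associated value in a finite group $(G,\oplus,{}^{-1},0)$ with $N=|G|$ elements. For any $\epsilon>0$, there is a data structure of $O((1/\epsilon)\,r\log N)$ bits that, given any rectangular range $[x_1,x_2]\times[y_1,y_2]$, computes the $\oplus$-sum of the values associated with the points lying in that range in time $O((1/\epsilon)\log^{2+\epsilon} r)$.
   Context: Computations are in the standard word-RAM model with words of $\Theta(\log r+\log N)$ bits; group operations are assumed to take constant time.
   Formalization: The space bound is claimed when log r = O(log N), its constant depending on that ratio (with N = 2 it fails: Ω(r log r) bits are needed); G is commutative, so that the sum over an unordered set is defined; constants are uniform for ε up to any fixed bound. *)

theory Defs
  imports Complex_Main "HOL-Algebra.FiniteProduct"
begin

text \<open>
  Registers and memory cells hold words, represented as natural numbers below \<open>2 ^ w\<close>; the word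
  size \<open>w\<close> is a parameter of the semantics, not of the programs.  The first argument of an
  instruction that produces a value is its destination register.
\<close>

datatype binop = Add | Sub | Mul | Div | Mod | And | Or | Xor | Shl | Shr

datatype instr =
    Const nat nat
  | Move nat nat
  | Arith binop nat nat nat
  | Load nat nat
  | Store nat nat  \<comment> \<open>address register, then value register\<close>
  | Jump nat
  | JumpIfZero nat nat  \<comment> \<open>tested register, then target\<close>
  | JumpIfLess nat nat nat  \<comment> \<open>compared registers, then target\<close>
  | GZero nat
  | GAdd nat nat nat
  | GInv nat nat

fun arith :: "nat \<Rightarrow> binop \<Rightarrow> nat \<Rightarrow> nat \<Rightarrow> nat" where
  "arith w Add a b = (a + b) mod 2 ^ w"
| "arith w Sub a b = (a + 2 ^ w - b) mod 2 ^ w"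
| "arith w Mul a b = (a * b) mod 2 ^ w"
| "arith w Div a b = a div b"
| "arith w Mod a b = a mod b"
| "arith w And a b = and a b"
| "arith w Or a b = or a b"
| "arith w Xor a b = xor a b"
| "arith w Shl a b = push_bit b a mod 2 ^ w"
| "arith w Shr a b = drop_bit b a"

record config =
  pc :: nat
  regs :: "nat \<Rightarrow> nat"
  mem :: "nat \<Rightarrow> nat"

definition set_reg :: "nat \<Rightarrow> nat \<Rightarrow> config \<Rightarrow> config" where
  "set_reg d a c = c\<lparr>pc := Suc (pc c), regs := (regs c)(d := a)\<rparr>"

definition jump_if :: "bool \<Rightarrow> nat \<Rightarrow> config \<Rightarrow> config" where
  "jump_if b l c = c\<lparr>pc := (if b then l else Suc (pc c))\<rparr>"

text \<open>
  HOL-Algebra writes groups multiplicatively: \<open>\<otimes>\<close>, \<open>\<one>\<close> and \<open>inv\<close> play the roles of the addition,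
  the zero and the inverse.  Group elements are words, so a finite group of order \<open>N\<close> enters as a
  group on \<open>{..<N}\<close>, that is, together with an arbitrary numbering of its elements.
  The guards keep the group instructions from reading the unspecified values of \<open>\<otimes>\<close> and \<open>inv\<close>
  outside the carrier.
\<close>

fun exec :: "nat \<Rightarrow> nat monoid \<Rightarrow> instr \<Rightarrow> config \<Rightarrow> config" where
  "exec w G (Const d n) c = set_reg d (n mod 2 ^ w) c"
| "exec w G (Move d s) c = set_reg d (regs c s) c"
| "exec w G (Arith f d s t) c = set_reg d (arith w f (regs c s) (regs c t)) c"
| "exec w G (Load d s) c = set_reg d (mem c (regs c s)) c"
| "exec w G (Store s t) c = c\<lparr>pc := Suc (pc c), mem := (mem c)(regs c s := regs c t)\<rparr>"
| "exec w G (Jump l) c = jump_if True l c"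
| "exec w G (JumpIfZero s l) c = jump_if (regs c s = 0) l c"
| "exec w G (JumpIfLess s t l) c = jump_if (regs c s < regs c t) l c"
| "exec w G (GZero d) c = set_reg d \<one>\<^bsub>G\<^esub> c"
| "exec w G (GAdd d s t) c =
     set_reg d (if regs c s \<in> carrier G \<and> regs c t \<in> carrier G
                then regs c s \<otimes>\<^bsub>G\<^esub> regs c t else 0) c"
| "exec w G (GInv d s) c =
     set_reg d (if regs c s \<in> carrier G then inv\<^bsub>G\<^esub> (regs c s) else 0) c"

text \<open>A program halts by leaving its own text; a halted configuration is a fixed point.\<close>

definition halted :: "instr list \<Rightarrow> config \<Rightarrow> bool" where
  "halted prog c \<longleftrightarrow> length prog \<le> pc c"

definition step :: "nat \<Rightarrow> nat monoid \<Rightarrow> instr list \<Rightarrow> config \<Rightarrow> config" where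
  "step w G prog c = (if halted prog c then c else exec w G (prog ! pc c) c)"

text \<open>
  The points in a range are unordered, so their sum is meaningful for commutative groups only.
\<close>

definition range_sum ::
  "nat monoid \<Rightarrow> (nat \<times> nat) set \<Rightarrow> (nat \<times> nat \<Rightarrow> nat) \<Rightarrow> nat \<Rightarrow> nat \<Rightarrow> nat \<Rightarrow> nat \<Rightarrow> nat" where
  "range_sum G P v x1 x2 y1 y2 = finprod G v (P \<inter> {x1..x2} \<times> {y1..y2})"

definition query_regs :: "nat \<Rightarrow> nat \<Rightarrow> nat \<Rightarrow> nat \<Rightarrow> nat \<Rightarrow> nat" where
  "query_regs x1 x2 y1 y2 = (\<lambda>_. 0)(0 := x1, 1 := x2, 2 := y1, 3 := y2)"

text \<open>
  The structure is the list \<open>D\<close> of words, placed at addresses \<open>0, \<dots>, length D - 1\<close>.  The remaining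
  memory is scratch space with arbitrary initial contents, so it carries no information about the
  points.  A query must leave \<open>D\<close> intact, which makes \<open>D\<close> reusable for any number of queries.
  The real number \<open>T\<close> bounds the number of executed instructions.
\<close>

definition answers_range_sums ::
  "nat \<Rightarrow> nat monoid \<Rightarrow> instr list \<Rightarrow> nat \<Rightarrow> (nat \<times> nat) set \<Rightarrow> (nat \<times> nat \<Rightarrow> nat)
     \<Rightarrow> nat list \<Rightarrow> real \<Rightarrow> bool" where
  "answers_range_sums w G prog r P v D T \<longleftrightarrow>
     length D \<le> 2 ^ w \<and> (\<forall>a \<in> set D. a < 2 ^ w) \<and>
     (\<forall>x1 x2 y1 y2 m.
        1 \<le> x1 \<and> x1 \<le> x2 \<and> x2 \<le> r \<and> 1 \<le> y1 \<and> y1 \<le> y2 \<and> y2 \<le> r \<and>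
        (\<forall>a. m a < 2 ^ w) \<and> (\<forall>i < length D. m i = D ! i) \<longrightarrow>
        (\<exists>t c. real t \<le> T \<and>
           c = (step w G prog ^^ t) \<lparr>pc = 0, regs = query_regs x1 x2 y1 y2, mem = m\<rparr> \<and>
           halted prog c \<and>
           regs c 0 = range_sum G P v x1 x2 y1 y2 \<and>
           (\<forall>i < length D. mem c i = D ! i)))"

text \<open>
  The usual convention for logarithms in complexity bounds: it only matters at arguments below 2,
  where a bound such as \<open>O(log r)\<close> would otherwise demand a computation of zero steps.

  A space bound of \<open>C * r * log N\<close> bits with one \<open>C\<close> for all \<open>r\<close> and \<open>N\<close> is impossible: if every
  point carries the nonzero element of the group of order 2, the answers to the queries on single
  cells determine the point set, and there are at least \<open>r!\<close> point sets.  Hence the constant of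
  the space bound must be allowed to depend on an upper bound for \<open>lg r / lg N\<close>, and likewise, as
  \<open>1 / \<epsilon>\<close> tends to 0, on an upper bound for \<open>\<epsilon>\<close>.
\<close>

definition lg :: "nat \<Rightarrow> real" where
  "lg n = max 1 (log 2 (real n))"

end

theory Submission
  imports Defs
begin

text \<open>
  Number the points by x-rank, pad their number to a power of two \<open>2 ^ K\<close>, and cut the ranks into
  nested nodes: on level \<open>i\<close> the nodes have \<open>lev i = 2 ^ (\<sigma> + i * d)\<close> elements, where
  \<open>2 ^ \<sigma>\<close> is about \<open>log r\<close> and the fan-out \<open>2 ^ d\<close> is about \<open>log r\<close> to the power
  \<open>\<epsilon> / 2\<close>.  On every level the elements of a node are listed by their y-rank.  A range is a
  signed combination of four quadrants, and a quadrant splits into at most \<open>2 ^ d\<close> nodes per level,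
  in each of which a prefix of the list must be summed.  Of these prefix sums only every
  \<open>2 ^ \<sigma>\<close>-th is stored; a binary search finds the right one, and the fewer than \<open>2 ^ \<sigma>\<close>
  remaining elements are looked up one by one.

  The values themselves are stored in the order of level 0 only.  To find an element there, a query
  follows jumps from level \<open>i\<close> to level \<open>i - u\<close>, where \<open>u\<close> is the largest power of
  \<open>2 ^ d\<close> dividing \<open>i\<close>; the number of jumps is the digit sum of \<open>i\<close> in base
  \<open>2 ^ d\<close>.  A jump over \<open>u\<close> levels needs about \<open>2 * d * u + \<sigma>\<close> bits per element, and
  since the base has about \<open>2 / \<epsilon>\<close> digits, these add up to \<open>O(K / \<epsilon>)\<close> bits per element,
  that is, \<open>O(1 / \<epsilon>)\<close> words.
\<close>

section \<open>Structured programs\<close>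

text \<open>Values must not be copied to every level, since the number of levels can grow with log
  r. Per level only \<open>2 ^ (K - \<sigma>)\<close> samples are kept, and as there are at most
  \<open>2 ^ \<sigma>\<close> levels, the samples of all levels fill just one column of
  \<open>2 ^ K\<close> words. The same count fixes the chunk length of a jump: a chunk has
  \<open>2 ^ \<sigma>\<close> times as many elements as the node has children, so one base per chunk
  and child again makes \<open>2 ^ (K - \<sigma>)\<close> entries per level.

  The time is the product of the number of levels (at most \<open>2 ^ \<sigma>\<close>), the nodes
  per level (\<open>2 ^ d\<close>), the elements examined per node (\<open>2 ^ \<sigma>\<close>) and
  the jumps per element (at most \<open>J * 2 ^ d\<close>, where \<open>J\<close> bounds the number
  of digits). The fan-out enters twice, as number of nodes and as digit bound; hence the exponent
  \<epsilon> / 2.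

  The program never writes to memory, so the structure survives trivially and a semantics of
  registers alone suffices. It reads all parameters from the table, which makes it one program for
  all inputs and all \<epsilon>.\<close>

datatype com =
    Blk "instr list"
  | Seq com com (infixr \<open>;;\<close> 60)
  | IfLess nat nat com
  | WhileLess nat nat com

fun clen :: "com \<Rightarrow> nat" where
  "clen (Blk is) = length is"
| "clen (a ;; b) = clen a + clen b"
| "clen (IfLess x y c) = clen c + 2"
| "clen (WhileLess x y c) = clen c + 3"

text \<open>Jump targets are absolute, hence the argument \<open>l\<close>, the address of the first
  instruction. A successful test jumps over the unconditional jump that leaves the command.\<close>

fun code :: "nat \<Rightarrow> com \<Rightarrow> instr list" where
  "code l (Blk is) = is"
| "code l (a ;; b) = code l a @ code (l + clen a) b"
| "code l (IfLess x y c) = [JumpIfLess x y (l + 2), Jump (l + 2 + clen c)] @ code (l + 2) c"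
| "code l (WhileLess x y c) =
     [JumpIfLess x y (l + 2), Jump (l + 3 + clen c)] @ code (l + 2) c @ [Jump l]"

lemma length_code [simp]: "length (code l c) = clen c"
  by (induction c arbitrary: l) auto

fun dest :: "instr \<Rightarrow> nat option" where
  "dest (Const d n) = Some d"
| "dest (Move d s) = Some d"
| "dest (Arith f d s t) = Some d"
| "dest (Load d s) = Some d"
| "dest (GZero d) = Some d"
| "dest (GAdd d s t) = Some d"
| "dest (GInv d s) = Some d"
| "dest _ = None"

fun writes :: "com \<Rightarrow> nat set" where
  "writes (Blk is) = set (List.map_filter dest is)"
| "writes (a ;; b) = writes a \<union> writes b"
| "writes (IfLess x y c) = writes c"
| "writes (WhileLess x y c) = writes c"

definition isem :: "nat \<Rightarrow> nat monoid \<Rightarrow> (nat \<Rightarrow> nat) \<Rightarrow> instr \<Rightarrow> (nat \<Rightarrow> nat) \<Rightarrow> nat \<Rightarrow> nat" where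
  "isem w G m i s = regs (exec w G i \<lparr>pc = 0, regs = s, mem = m\<rparr>)"

lemma isem_simps [simp]:
  "isem w G m (Const d n) s = s(d := n mod 2 ^ w)"
  "isem w G m (Move d a) s = s(d := s a)"
  "isem w G m (Arith f d a b) s = s(d := arith w f (s a) (s b))"
  "isem w G m (Load d a) s = s(d := m (s a))"
  "isem w G m (GZero d) s = s(d := \<one>\<^bsub>G\<^esub>)"
  "isem w G m (GAdd d a b) s =
     s(d := if s a \<in> carrier G \<and> s b \<in> carrier G then s a \<otimes>\<^bsub>G\<^esub> s b else 0)"
  "isem w G m (GInv d a) s = s(d := if s a \<in> carrier G then inv\<^bsub>G\<^esub> (s a) else 0)"
  by (simp_all add: isem_def set_reg_def)

lemma exec_plain:
  assumes "dest i \<noteq> None"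
  shows "exec w G i \<lparr>pc = l, regs = s, mem = m\<rparr> = \<lparr>pc = Suc l, regs = isem w G m i s, mem = m\<rparr>"
  using assms by (cases i) (simp_all add: set_reg_def)

lemma isem_other: "dest i \<noteq> Some x \<Longrightarrow> dest i \<noteq> None \<Longrightarrow> isem w G m i s x = s x"
  by (cases i) auto

text \<open>The memory is a mere parameter because the condition on \<open>dest\<close> bars
  \<open>Store\<close> from blocks. The time is the exact number of executed instructions: 2 for a
  failed test with its exit jump, and one more per iteration for the jump back.\<close>

inductive big :: "nat \<Rightarrow> nat monoid \<Rightarrow> (nat \<Rightarrow> nat) \<Rightarrow> com \<Rightarrow> (nat \<Rightarrow> nat) \<Rightarrow> nat \<Rightarrow> (nat \<Rightarrow> nat) \<Rightarrow> bool"
  for w G m where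
  Blk: "\<forall>i\<in>set is. dest i \<noteq> None \<Longrightarrow> big w G m (Blk is) s (length is) (fold (isem w G m) is s)"
| Seq: "big w G m a s t s1 \<Longrightarrow> big w G m b s1 t' s2 \<Longrightarrow> big w G m (a ;; b) s (t + t') s2"
| IfT: "s x < s y \<Longrightarrow> big w G m c s t s1 \<Longrightarrow> big w G m (IfLess x y c) s (1 + t) s1"
| IfF: "\<not> s x < s y \<Longrightarrow> big w G m (IfLess x y c) s 2 s"
| WhileT: "s x < s y \<Longrightarrow> big w G m c s t s1 \<Longrightarrow> big w G m (WhileLess x y c) s1 t' s2
     \<Longrightarrow> big w G m (WhileLess x y c) s (1 + (t + (1 + t'))) s2"
| WhileF: "\<not> s x < s y \<Longrightarrow> big w G m (WhileLess x y c) s 2 s"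

lemma funpow_trans:
  assumes "(f ^^ t) a = b" "(f ^^ t') b = c"
  shows "(f ^^ (t + t')) a = c"
  using assms by (simp add: add.commute[of t] funpow_add)

lemma step_at:
  assumes "l = length pre" "prog = pre @ i # post"
  shows "step w G prog \<lparr>pc = l, regs = s, mem = m\<rparr> = exec w G i \<lparr>pc = l, regs = s, mem = m\<rparr>"
  using assms by (simp add: step_def halted_def nth_append)

lemma step_plains:
  assumes "\<forall>i\<in>set is. dest i \<noteq> None"
  shows "(step w G (pre @ is @ post) ^^ length is) \<lparr>pc = length pre, regs = s, mem = m\<rparr>
     = \<lparr>pc = length pre + length is, regs = fold (isem w G m) is s, mem = m\<rparr>"
  using assms
proof (induction "is" arbitrary: pre s)
  case (Cons i "is")
  have 1: "(step w G (pre @ (i # is) @ post) ^^ 1) \<lparr>pc = length pre, regs = s, mem = m\<rparr>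
     = \<lparr>pc = Suc (length pre), regs = isem w G m i s, mem = m\<rparr>"
    using Cons.prems exec_plain[of i] by (simp add: step_at)
  have 2: "(step w G (pre @ (i # is) @ post) ^^ length is)
      \<lparr>pc = Suc (length pre), regs = isem w G m i s, mem = m\<rparr>
     = \<lparr>pc = length pre + length (i # is), regs = fold (isem w G m) (i # is) s, mem = m\<rparr>"
    using Cons.IH[of "pre @ [i]" "isem w G m i s"] Cons.prems by simp
  show ?case using funpow_trans[OF 1 2] by simp
qed simp

lemma big_runs:
  assumes "big w G m c s t s'"
  shows "(step w G (pre @ code (length pre) c @ post) ^^ t) \<lparr>pc = length pre, regs = s, mem = m\<rparr>
     = \<lparr>pc = length pre + clen c, regs = s', mem = m\<rparr>"
  using assms
proof (induction arbitrary: pre post rule: big.induct)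
  case (Blk "is" s)
  then show ?case by (simp add: step_plains)
next
  case (Seq a s t s1 b t' s2)
  show ?case
    using funpow_trans[OF Seq.IH(1)[of pre "code (length pre + clen a) b @ post"]]
      Seq.IH(2)[of "pre @ code (length pre) a" post]
    by (simp add: add.assoc)
next
  case (IfT s x y c t s1)
  let ?prog = "pre @ code (length pre) (IfLess x y c) @ post"
  have 1: "(step w G ?prog ^^ 1) \<lparr>pc = length pre, regs = s, mem = m\<rparr>
      = \<lparr>pc = length pre + 2, regs = s, mem = m\<rparr>"
    using IfT.hyps(1) by (simp add: step_at jump_if_def)
  show ?case
    using funpow_trans[OF 1] IfT.IH[of "pre @ [JumpIfLess x y (length pre + 2),
      Jump (length pre + 2 + clen c)]" post]
    by (simp add: add_ac)
next
  case (IfF s x y c)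
  let ?prog = "pre @ code (length pre) (IfLess x y c) @ post"
  have 1: "step w G ?prog \<lparr>pc = length pre, regs = s, mem = m\<rparr>
      = \<lparr>pc = length pre + 1, regs = s, mem = m\<rparr>"
    using IfF.hyps(1) by (simp add: step_at jump_if_def)
  have 2: "step w G ?prog \<lparr>pc = length pre + 1, regs = s, mem = m\<rparr>
      = \<lparr>pc = length pre + clen (IfLess x y c), regs = s, mem = m\<rparr>"
    by (subst step_at[where pre = "pre @ [JumpIfLess x y (length pre + 2)]"])
      (auto simp: jump_if_def)
  show ?case using 1 2 by (simp add: numeral_2_eq_2)
next
  case (WhileT s x y c t s1 t' s2)
  let ?prog = "pre @ code (length pre) (WhileLess x y c) @ post"
  have 1: "(step w G ?prog ^^ 1) \<lparr>pc = length pre, regs = s, mem = m\<rparr>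
      = \<lparr>pc = length pre + 2, regs = s, mem = m\<rparr>"
    using WhileT.hyps(1) by (simp add: step_at jump_if_def)
  have 2: "(step w G ?prog ^^ t) \<lparr>pc = length pre + 2, regs = s, mem = m\<rparr>
      = \<lparr>pc = length pre + 2 + clen c, regs = s1, mem = m\<rparr>"
    using WhileT.IH(1)[of "pre @ [JumpIfLess x y (length pre + 2), Jump (length pre + 3 + clen c)]"
      "Jump (length pre) # post"] by (simp add: add_ac)
  have 3: "(step w G ?prog ^^ 1) \<lparr>pc = length pre + 2 + clen c, regs = s1, mem = m\<rparr>
      = \<lparr>pc = length pre, regs = s1, mem = m\<rparr>"
    by (simp, subst step_at[where pre = "pre @ [JumpIfLess x y (length pre + 2),
      Jump (length pre + 3 + clen c)] @ code (length pre + 2) c"]) (auto simp: jump_if_def)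
  show ?case
    by (rule funpow_trans[OF 1 funpow_trans[OF 2 funpow_trans[OF 3 WhileT.IH(2)]]])
next
  case (WhileF s x y c)
  let ?prog = "pre @ code (length pre) (WhileLess x y c) @ post"
  have 1: "step w G ?prog \<lparr>pc = length pre, regs = s, mem = m\<rparr>
      = \<lparr>pc = length pre + 1, regs = s, mem = m\<rparr>"
    using WhileF.hyps(1) by (simp add: step_at jump_if_def)
  have 2: "step w G ?prog \<lparr>pc = length pre + 1, regs = s, mem = m\<rparr>
      = \<lparr>pc = length pre + clen (WhileLess x y c), regs = s, mem = m\<rparr>"
    by (subst step_at[where pre = "pre @ [JumpIfLess x y (length pre + 2)]"])
      (auto simp: jump_if_def)
  show ?case using 1 2 by (simp add: numeral_2_eq_2)
qed

lemma fold_isem_other: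
  assumes "x \<notin> set (List.map_filter dest is)" "\<forall>i\<in>set is. dest i \<noteq> None"
  shows "fold (isem w G m) is s x = s x"
  using assms by (induction "is" arbitrary: s) (auto simp: isem_other List.map_filter_simps split: option.splits)

lemma big_frame: "big w G m c s t s' \<Longrightarrow> x \<notin> writes c \<Longrightarrow> s' x = s x"
  by (induction rule: big.induct) (auto simp: fold_isem_other)

text \<open>Total correctness with time budget \<open>T\<close>, from one fixed initial state
  \<open>s\<close>, so that postconditions may refer to the initial registers directly.\<close>

definition ev :: "nat \<Rightarrow> nat monoid \<Rightarrow> (nat \<Rightarrow> nat) \<Rightarrow> com \<Rightarrow> (nat \<Rightarrow> nat) \<Rightarrow> nat
     \<Rightarrow> ((nat \<Rightarrow> nat) \<Rightarrow> bool) \<Rightarrow> bool" where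
  "ev w G m c s T Q \<longleftrightarrow> (\<exists>t\<le>T. \<exists>s'. big w G m c s t s' \<and> Q s')"

lemma ev_mono: "ev w G m c s T Q \<Longrightarrow> T \<le> T' \<Longrightarrow> (\<And>s'. Q s' \<Longrightarrow> Q' s') \<Longrightarrow> ev w G m c s T' Q'"
  unfolding ev_def by (meson order_trans)

lemma ev_frame:
  "ev w G m c s T Q \<Longrightarrow> ev w G m c s T (\<lambda>s'. Q s' \<and> (\<forall>x. x \<notin> writes c \<longrightarrow> s' x = s x))"
  unfolding ev_def using big_frame by blast

lemma ev_Blk:
  assumes "\<forall>i\<in>set is. dest i \<noteq> None" "length is \<le> T" "Q (fold (isem w G m) is s)"
  shows "ev w G m (Blk is) s T Q"
  unfolding ev_def using assms big.Blk by blast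

lemma ev_Seq:
  assumes "ev w G m a s T Q'" "\<And>s'. Q' s' \<Longrightarrow> (\<forall>x. x \<notin> writes a \<longrightarrow> s' x = s x) \<Longrightarrow> ev w G m b s' T' Q"
    "T + T' \<le> U"
  shows "ev w G m (a ;; b) s U Q"
proof -
  obtain t s1 where 1: "t \<le> T" "big w G m a s t s1" "Q' s1" using assms(1) ev_def by auto
  then obtain t' s2 where 2: "t' \<le> T'" "big w G m b s1 t' s2" "Q s2"
    using assms(2) big_frame[OF 1(2)] unfolding ev_def by meson
  show ?thesis unfolding ev_def using big.Seq[OF 1(2) 2(2)] 1 2 assms(3)
    by (meson add_mono order_trans)
qed

lemma ev_Blk_Seq:
  assumes "\<forall>i\<in>set is. dest i \<noteq> None" "ev w G m b (fold (isem w G m) is s) T Q" "length is + T \<le> U"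
  shows "ev w G m (Blk is ;; b) s U Q"
  by (rule ev_Seq[where Q' = "\<lambda>s'. s' = fold (isem w G m) is s" and T = "length is" and T' = T])
    (use assms in \<open>auto intro: ev_Blk\<close>)

lemma ev_If:
  assumes "s x < s y \<Longrightarrow> ev w G m c s T Q" "\<not> s x < s y \<Longrightarrow> Q s" "T + 2 \<le> U"
  shows "ev w G m (IfLess x y c) s U Q"
proof (cases "s x < s y")
  case True
  then obtain t s1 where 1: "t \<le> T" "big w G m c s t s1" "Q s1" using assms(1) ev_def by auto
  show ?thesis unfolding ev_def using big.IfT[where s=s and x=x and y=y, OF True 1(2)] 1 assms(3)
    by (intro exI[of _ "1 + t"]) auto
next
  case False
  then show ?thesis unfolding ev_def using big.IfF[where s=s and x=x and y=y, OF False] assms(2,3) False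
    by (intro exI[of _ 2] conjI exI[of _ s]) auto
qed

text \<open>The variant \<open>n\<close> also bounds the number of iterations. Both premises on the
  body receive the frame relative to the state before the loop, so an invariant only has to mention
  registers that change.\<close>

lemma ev_While:
  assumes "I n s"
    and step: "\<And>k s'. I k s' \<Longrightarrow> s' x < s' y \<Longrightarrow> (\<forall>z. z \<notin> writes c \<longrightarrow> s' z = s z)
      \<Longrightarrow> ev w G m c s' T (\<lambda>s''. \<exists>k'<k. I k' s'')"
    and fin: "\<And>k s'. I k s' \<Longrightarrow> \<not> s' x < s' y \<Longrightarrow> (\<forall>z. z \<notin> writes c \<longrightarrow> s' z = s z) \<Longrightarrow> Q s'"
    and U: "n * (T + 2) + 2 \<le> U"
  shows "ev w G m (WhileLess x y c) s U Q"
proof -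
  have "\<exists>t\<le>k * (T + 2) + 2. \<exists>s''. big w G m (WhileLess x y c) s' t s'' \<and> Q s''"
    if "I k s'" "\<forall>z. z \<notin> writes c \<longrightarrow> s' z = s z" for k s'
    using that
  proof (induction k arbitrary: s' rule: less_induct)
    case (less k)
    show ?case
    proof (cases "s' x < s' y")
      case True
      obtain t s1 k' where 1: "t \<le> T" "big w G m c s' t s1" "k' < k" "I k' s1"
        using step[OF less.prems(1) True less.prems(2)] unfolding ev_def by auto
      have "\<forall>z. z \<notin> writes c \<longrightarrow> s1 z = s z" using big_frame[OF 1(2)] less.prems(2) by simp
      from less.IH[OF 1(3,4) this]
      obtain t' s2 where 2: "t' \<le> k' * (T + 2) + 2" "big w G m (WhileLess x y c) s1 t' s2" "Q s2"
        by auto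
      have "Suc k' * (T + 2) \<le> k * (T + 2)" using 1(3) by (intro mult_le_mono1) simp
      then show ?thesis using big.WhileT[where s=s' and x=x and y=y, OF True 1(2) 2(2)] 1(1) 2
        by (intro exI[of _ "1 + (t + (1 + t'))"]) auto
    next
      case False
      then show ?thesis using big.WhileF[where s=s' and x=x and y=y, OF False] fin[OF less.prems(1) False less.prems(2)]
        by (intro exI[of _ 2] conjI exI[of _ s']) auto
    qed
  qed
  from this[OF assms(1)] show ?thesis unfolding ev_def using U by (meson order_trans)
qed

section \<open>Digits, packed fields and node orders\<close>

text \<open>The jump length: the largest power of \<open>q\<close> dividing \<open>i\<close>. The
  cases \<open>i = 0\<close> and \<open>q < 2\<close> are there for termination.\<close>

function stp :: "nat \<Rightarrow> nat \<Rightarrow> nat" where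
  "stp q i = (if i = 0 \<or> q < 2 \<or> \<not> q dvd i then 1 else q * stp q (i div q))"
  by pat_completeness auto
termination by (relation "measure snd") auto

function dsum :: "nat \<Rightarrow> nat \<Rightarrow> nat" where
  "dsum q i = (if i = 0 \<or> q < 2 then 0 else i mod q + dsum q (i div q))"
  by pat_completeness auto
termination by (relation "measure snd") auto

declare stp.simps [simp del] dsum.simps [simp del]

lemma stp_mult: "0 < i \<Longrightarrow> 2 \<le> q \<Longrightarrow> stp q (q * i) = q * stp q i"
  by (subst stp.simps) auto

lemma stp_ndvd: "\<not> q dvd i \<Longrightarrow> stp q i = 1"
  by (subst stp.simps) auto

lemma dsum_0 [simp]: "dsum q 0 = 0"
  by (subst dsum.simps) auto

lemma dsum_rec: "2 \<le> q \<Longrightarrow> dsum q i = i mod q + dsum q (i div q)"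
  by (cases "i = 0") (simp_all add: dsum.simps[of q i])

text \<open>Induction on the number of trailing zeros of \<open>i\<close> in base
  \<open>q\<close>.\<close>

lemma base_induct [consumes 2, case_names ndvd mult]:
  fixes i q :: nat
  assumes "0 < i" "2 \<le> q"
    and "\<And>i. 0 < i \<Longrightarrow> \<not> q dvd i \<Longrightarrow> P i"
    and "\<And>i. 0 < i \<Longrightarrow> P i \<Longrightarrow> P (q * i)"
  shows "P i"
  using assms(1)
proof (induction i rule: less_induct)
  case (less i)
  show ?case
  proof (cases "q dvd i")
    case True
    then obtain j where j: "i = q * j" by blast
    then have "0 < j" "j < i" using less.prems assms(2) by auto
    then show ?thesis using j less.IH[of j] assms(4) by simp
  qed (use less.prems assms(3) in simp)
qed

lemma stp_dvd:
  assumes "0 < i" "2 \<le> q"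
  shows "stp q i dvd i"
  using assms by (induction rule: base_induct) (use assms(2) in \<open>auto simp: stp_ndvd stp_mult\<close>)

lemma stp_le: "0 < i \<Longrightarrow> 2 \<le> q \<Longrightarrow> stp q i \<le> i"
  using stp_dvd dvd_imp_le by blast

lemma stp_pos: "0 < i \<Longrightarrow> 2 \<le> q \<Longrightarrow> 0 < stp q i"
  using stp_dvd[of i q] by (cases "stp q i = 0") auto

text \<open>\<open>stp q i\<close> is the place value of the lowest nonzero digit; subtracting it
  lowers that digit by one and changes no other.\<close>

lemma dsum_diff_stp:
  assumes "0 < i" "2 \<le> q"
  shows "Suc (dsum q (i - stp q i)) = dsum q i"
  using assms
proof (induction rule: base_induct)
  case (ndvd i)
  obtain j where j: "i = Suc j" using ndvd by (cases i) auto
  have m: "Suc j mod q \<noteq> 0" using ndvd j by (simp add: dvd_eq_mod_eq_0)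
  then have "Suc j mod q = Suc (j mod q)" by (simp add: mod_Suc split: if_splits)
  moreover have "Suc j div q = j div q" using m by (simp add: div_Suc)
  ultimately show ?case using j ndvd dsum_rec[OF assms(2), of i] dsum_rec[OF assms(2), of j]
    by (simp add: stp_ndvd)
next
  case (mult i)
  have "q * i - q * stp q i = q * (i - stp q i)" by (simp add: diff_mult_distrib2)
  then show ?case
    using mult assms(2) dsum_rec[OF assms(2), of "q * i"]
      dsum_rec[OF assms(2), of "q * (i - stp q i)"] by (simp add: stp_mult)
qed

lemma dsum_le:
  assumes "2 \<le> q" "i < q ^ J"
  shows "dsum q i \<le> J * (q - 1)"
  using assms(2)
proof (induction J arbitrary: i)
  case (Suc J)
  have "i div q < q ^ J" using Suc.prems assms(1) by (simp add: less_mult_imp_div_less mult.commute)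
  moreover have "i mod q \<le> q - 1" using assms(1) by (simp add: less_Suc_eq_le[symmetric])
  ultimately show ?case using Suc.IH[of "i div q"] dsum_rec[OF assms(1), of i] by simp
qed simp

lemma stp_power:
  assumes "0 < i" "2 \<le> q" "i < q ^ J"
  shows "\<exists>j<J. stp q i = q ^ j"
  using assms
proof (induction arbitrary: J rule: base_induct)
  case (ndvd i)
  then show ?case by (intro exI[of _ 0]) (cases J; simp add: stp_ndvd)
next
  case (mult i)
  obtain J' where J': "J = Suc J'" using mult assms(2) by (cases J) auto
  then obtain j where "j < J'" "stp q i = q ^ j" using mult assms(2) by auto
  then show ?case using J' mult.hyps assms(2) by (intro exI[of _ "Suc j"]) (simp add: stp_mult)
qed

lemma sum_multiples_le:
  fixes u n :: nat
  shows "(\<Sum>i=1..n. if u dvd i then u else 0) \<le> n"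
proof -
  have "(\<Sum>i=1..n. if u dvd i then u else 0) = u * (n div u)"
    by (induction n) (auto simp: div_Suc dvd_eq_mod_eq_0)
  then show ?thesis by simp
qed

text \<open>Each \<open>stp q i\<close> is one of the powers \<open>q ^ j\<close> with
  \<open>j < J\<close> that divide \<open>i\<close>, so it is at most the sum of all of these. After
  exchanging the sums, each of the \<open>J\<close> powers contributes at most
  \<open>n\<close>.\<close>

lemma sum_stp_le:
  assumes "2 \<le> q" "n < q ^ J"
  shows "(\<Sum>i=1..n. stp q i) \<le> J * n"
proof -
  have "stp q i \<le> (\<Sum>j<J. if q ^ j dvd i then q ^ j else 0)" if i: "i \<in> {1..n}" for i
  proof -
    obtain j where j: "j < J" "stp q i = q ^ j" using stp_power[of i q J] assms i by auto
    have "q ^ j dvd i" using j(2) stp_dvd[of i q] assms i by simp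
    then show ?thesis
      using member_le_sum[of j "{..<J}" "\<lambda>j. if q ^ j dvd i then q ^ j else 0"] j by auto
  qed
  then have "(\<Sum>i=1..n. stp q i) \<le> (\<Sum>i=1..n. \<Sum>j<J. if q ^ j dvd i then q ^ j else 0)"
    by (rule sum_mono)
  also have "\<dots> = (\<Sum>j<J. \<Sum>i=1..n. if q ^ j dvd i then q ^ j else 0)" by (rule sum.swap)
  also have "\<dots> \<le> (\<Sum>j<J. n)" by (intro sum_mono sum_multiples_le)
  finally show ?thesis by simp
qed

text \<open>Concatenation of bit fields of varying width, with field 0 lowest; the induction puts
  the new field on top, which leaves the lower ones unchanged.\<close>

lemma packing:
  fixes x :: "nat \<Rightarrow> nat"
  assumes "\<And>i. i < h \<Longrightarrow> x i < 2 ^ b i"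
  shows "\<exists>W. W < 2 ^ (\<Sum>j<h. b j) \<and> (\<forall>i<h. (W div 2 ^ (\<Sum>j<i. b j)) mod 2 ^ b i = x i)"
  using assms
proof (induction h)
  case (Suc h)
  let ?B = "\<lambda>i. \<Sum>j<i. b j"
  obtain W where W: "W < 2 ^ ?B h" "\<And>i. i < h \<Longrightarrow> (W div 2 ^ ?B i) mod 2 ^ b i = x i"
    using Suc by auto
  let ?W = "W + 2 ^ ?B h * x h"
  have "?W < 2 ^ ?B h * Suc (x h)" using W(1) by simp
  also have "\<dots> \<le> 2 ^ ?B h * 2 ^ b h" using Suc.prems[of h] by (intro mult_le_mono2) simp
  finally have "?W < 2 ^ ?B (Suc h)" by (simp add: power_add)
  moreover have "(?W div 2 ^ ?B i) mod 2 ^ b i = x i" if "i < Suc h" for i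
  proof (cases "i = h")
    case True
    then show ?thesis using W(1) Suc.prems[of h] by simp
  next
    case False
    then have i: "i < h" using that by simp
    have "?B (Suc i) \<le> ?B h" using i by (intro sum_mono2) auto
    then obtain e where e: "?B h = ?B i + b i + e" by (auto simp: le_iff_add)
    have "?W div 2 ^ ?B i = W div 2 ^ ?B i + 2 ^ b i * (2 ^ e * x h)"
      unfolding e by (simp add: power_add mult.assoc)
    then show ?thesis using W(2)[OF i] by simp
  qed
  ultimately show ?case by blast
qed simp

lemma window:
  fixes W :: nat
  assumes "o' + b \<le> V"
  shows "(W div 2 ^ g mod 2 ^ V) div 2 ^ o' mod 2 ^ b = W div 2 ^ (g + o') mod 2 ^ b"
proof -
  have "take_bit b (drop_bit o' (take_bit V (drop_bit g W))) = take_bit b (drop_bit (g + o') W)"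
    using assms by (simp add: drop_bit_take_bit take_bit_take_bit add.commute)
  then show ?thesis by (simp add: take_bit_eq_mod drop_bit_eq_div)
qed

section \<open>Orders of the elements by nodes and y-ranks\<close>

locale ranked =
  fixes R :: nat and yr :: "nat \<Rightarrow> nat"
  assumes inj_yr: "inj_on yr {..<R}"
begin

text \<open>A node occupies the same block of positions on its level as its elements do in x-order;
  inside the block they are sorted by y-rank.\<close>

definition pos :: "nat \<Rightarrow> nat \<Rightarrow> nat" where
  "pos M e = M * (e div M) + card {e'. e' < R \<and> e' div M = e div M \<and> yr e' < yr e}"

definition el :: "nat \<Rightarrow> nat \<Rightarrow> nat" where
  "el M = inv_into {..<R} (pos M)"

context
  fixes M :: nat
  assumes M: "0 < M" "M dvd R"
begin

lemma card_node_less: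
  assumes "e < R"
  shows "card {e'. e' < R \<and> e' div M = e div M \<and> yr e' < yr e} < M"
proof -
  let ?I = "{M * (e div M)..<M * (e div M) + M}"
  have I: "e' \<in> ?I" if "e' div M = e div M" for e'
    using mult_div_mod_eq[of M e'] mod_less_divisor[OF M(1), of e'] unfolding that atLeastLessThan_iff
    by linarith
  have "{e'. e' < R \<and> e' div M = e div M \<and> yr e' < yr e} \<subset> ?I" using I by blast
  from psubset_card_mono[OF _ this] show ?thesis by simp
qed

lemma pos_div: "e < R \<Longrightarrow> pos M e div M = e div M"
  using card_node_less[of e] M by (simp add: pos_def)

lemma pos_less: "e < R \<Longrightarrow> pos M e < R"
proof -
  assume e: "e < R"
  obtain t where t: "R = M * t" using M by blast
  have "e div M < t" using e t by (simp add: less_mult_imp_div_less mult.commute)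
  then have "pos M e div M < t" using pos_div[OF e] by simp
  then show ?thesis using t M by (simp add: div_less_iff_less_mult mult.commute)
qed

lemma pos_strict:
  assumes "e < R" "e div M = e' div M" "yr e < yr e'"
  shows "pos M e < pos M e'"
proof -
  have "{f. f < R \<and> f div M = e div M \<and> yr f < yr e} \<subset> {f. f < R \<and> f div M = e' div M \<and> yr f < yr e'}"
    using assms by auto
  from psubset_card_mono[OF _ this] show ?thesis using assms(2) by (simp add: pos_def)
qed

lemma pos_less_iff:
  assumes "e < R" "e' < R" "e div M = e' div M"
  shows "pos M e < pos M e' \<longleftrightarrow> yr e < yr e'"
proof -
  consider "yr e < yr e'" | "yr e = yr e'" | "yr e' < yr e" by linarith
  then show ?thesis
  proof cases
    case 2
    then show ?thesis using assms(3) by (simp add: pos_def)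
  qed (use assms pos_strict[of e e'] pos_strict[of e' e] in auto)
qed

lemma inj_pos: "inj_on (pos M) {..<R}"
proof (rule inj_onI)
  fix e e' assume e: "e \<in> {..<R}" "e' \<in> {..<R}" "pos M e = pos M e'"
  then have "e div M = e' div M" using pos_div[of e] pos_div[of e'] by simp
  then have "\<not> yr e < yr e'" "\<not> yr e' < yr e"
    using pos_less_iff[of e e'] pos_less_iff[of e' e] e by auto
  then show "e = e'" using inj_yr e by (auto dest: inj_onD)
qed

lemma bij_pos: "bij_betw (pos M) {..<R} {..<R}"
  using endo_inj_surj[OF _ _ inj_pos] pos_less inj_pos by (auto simp: bij_betw_def)

lemma el_less: "p < R \<Longrightarrow> el M p < R"
  unfolding el_def using inv_into_into[of p "pos M" "{..<R}"] bij_pos by (auto simp: bij_betw_def)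

lemma pos_el: "p < R \<Longrightarrow> pos M (el M p) = p"
  unfolding el_def using f_inv_into_f[of p "pos M" "{..<R}"] bij_pos by (auto simp: bij_betw_def)

lemma el_pos: "e < R \<Longrightarrow> el M (pos M e) = e"
  unfolding el_def using inv_into_f_f[OF inj_pos] by simp

lemma el_div: "p < R \<Longrightarrow> el M p div M = p div M"
  using pos_div[of "el M p"] el_less pos_el by simp

end

text \<open>\<open>\<kappa> * c div M\<close> is the node containing chunk \<open>\<kappa>\<close>,
  and \<open>E\<close> times it plus \<open>l\<close> is its child number \<open>l\<close>. The
  elements of the chunk begin in that child behind those that precede the chunk in the order of the
  parent.\<close>

definition base :: "nat \<Rightarrow> nat \<Rightarrow> nat \<Rightarrow> nat \<Rightarrow> nat \<Rightarrow> nat \<Rightarrow> nat" where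
  "base M M' E c \<kappa> l = M' * (E * (\<kappa> * c div M) + l)
     + card {e. e < R \<and> e div M' = E * (\<kappa> * c div M) + l \<and> pos M e < \<kappa> * c}"

definition rnk :: "nat \<Rightarrow> nat \<Rightarrow> nat \<Rightarrow> nat \<Rightarrow> nat" where
  "rnk M M' c e = card {e'. e' < R \<and> e' div M' = e div M' \<and> pos M e div c * c \<le> pos M e' \<and> yr e' < yr e}"

text \<open>
  Elements of a chunk of \<open>c\<close> consecutive positions that go to the same child stay in the same
  order, so one base position per chunk and child suffices, plus an offset below \<open>c\<close> per element.
\<close>

lemma pos_jump:
  assumes M: "0 < M" "M dvd R" "M = M' * E" and c: "0 < c" "c dvd M" and e: "e < R"
  shows "pos M' e = base M M' E c (pos M e div c) (e div M' mod E) + rnk M M' c e"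
    and "rnk M M' c e < c"
proof -
  define \<kappa> where "\<kappa> = pos M e div c"
  obtain t where t: "M = c * t" using c by blast
  have ediv: "f div M = f div M' div E" for f by (simp only: M(3) div_mult2_eq)
  have "\<kappa> * c div M = \<kappa> * c div c div t" by (simp only: t div_mult2_eq)
  also have "\<dots> = pos M e div c div t" using c(1) by (simp add: \<kappa>_def)
  also have "\<dots> = pos M e div M" by (simp only: t div_mult2_eq)
  also have "\<dots> = e div M" by (rule pos_div[OF M(1,2) e])
  finally have "E * (\<kappa> * c div M) + e div M' mod E = E * (e div M) + e div M' mod E" by (rule arg_cong)
  also have "\<dots> = e div M'" unfolding ediv[of e] by (rule mult_div_mod_eq)
  finally have n: "E * (\<kappa> * c div M) + e div M' mod E = e div M'" .
  have up: "f div M = e div M" if "f div M' = e div M'" for f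
    using that by (simp only: ediv)
  have \<kappa>: "\<kappa> * c \<le> pos M e" by (simp add: \<kappa>_def)
  \<comment> \<open>What precedes \<open>e\<close> in its child comes from earlier chunks of the
    parent (\<open>?A\<close>, counted by \<open>base\<close>) or from the chunk of \<open>e\<close>
    itself (\<open>?B\<close>, counted by \<open>rnk\<close>). For \<open>?A\<close> the y-ranks are
    smaller automatically, as the parent is sorted by them.\<close>
  let ?A = "{f. f < R \<and> f div M' = e div M' \<and> pos M f < \<kappa> * c}"
  let ?B = "{f. f < R \<and> f div M' = e div M' \<and> \<kappa> * c \<le> pos M f \<and> yr f < yr e}"
  have "yr f < yr e" if "f \<in> ?A" for f
    using that up[of f] pos_less_iff[OF M(1,2), of f e] e \<kappa> by auto
  then have "{f. f < R \<and> f div M' = e div M' \<and> yr f < yr e} = ?A \<union> ?B" by auto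
  moreover have "card (?A \<union> ?B) = card ?A + card ?B" by (rule card_Un_disjoint) auto
  ultimately have "card {f. f < R \<and> f div M' = e div M' \<and> yr f < yr e} = card ?A + card ?B" by (simp only:)
  then show "pos M' e = base M M' E c (pos M e div c) (e div M' mod E) + rnk M M' c e"
    unfolding pos_def[of M' e] base_def rnk_def \<kappa>_def[symmetric] n by (simp only: add.assoc)
  \<comment> \<open>The members of \<open>?B\<close> occupy distinct positions of the chunk before
    that of \<open>e\<close>, so there are fewer than \<open>c\<close>.\<close>
  have "pos M f < pos M e" if "f \<in> ?B" for f
    using that up[of f] pos_strict[OF M(1,2), of f e] by blast
  then have "pos M ` ?B \<subseteq> {\<kappa> * c..<pos M e}" by auto
  moreover have "inj_on (pos M) ?B" using inj_pos[OF M(1,2)] by (rule inj_on_subset) auto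
  ultimately have "card ?B \<le> pos M e - \<kappa> * c"
    using card_inj_on_le[of "pos M" ?B "{\<kappa> * c..<pos M e}"] by simp
  also have "\<dots> < c" using c by (simp add: \<kappa>_def minus_div_mult_eq_mod)
  finally show "rnk M M' c e < c" by (simp add: rnk_def \<kappa>_def)
qed

text \<open>Samples stand at the multiples of \<open>s\<close>, and \<open>k\<close> is the last one
  below \<open>Y\<close>, or the first of the node. All elements before it are below
  \<open>Y\<close> and all from sample \<open>k + 1\<close> on are not, so only \<open>s\<close>
  elements remain undecided. The prefix ignores \<open>X\<close>, which is sound if the node lies
  left of \<open>X\<close>, or if it has a single sample and hence an empty prefix.\<close>

lemma node_split:
  assumes M: "0 < M" "M dvd R" "M = B * s" and s: "0 < s" and n: "Suc n * M \<le> R"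
    and k: "n * B \<le> k" "k < n * B + B"
    and lo: "k = n * B \<or> yr (el M (k * s)) < Y"
    and hi: "k + 1 = n * B + B \<or> Y \<le> yr (el M ((k + 1) * s))"
    and X: "Suc n * M \<le> X \<or> M = s"
  shows "{e. e < R \<and> e div M = n \<and> e < X \<and> yr e < Y} =
    {e. e < R \<and> e div M = k * s div M \<and> pos M e < k * s} \<union>
    {e. e < R \<and> k * s \<le> pos M e \<and> pos M e < k * s + s \<and> e < X \<and> yr e < Y}"
proof -
  have ks: "n * M \<le> k * s" "k * s + s \<le> Suc n * M"
  proof -
    show "n * M \<le> k * s" using mult_le_mono1[OF k(1), of s] by (simp add: M(3) mult.assoc)
    have "Suc k * s \<le> Suc n * B * s" using k(2) by (intro mult_le_mono1) simp
    then show "k * s + s \<le> Suc n * M" by (simp add: M(3) algebra_simps)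
  qed
  have node: "p div M = n \<longleftrightarrow> n * M \<le> p \<and> p < Suc n * M" for p
  proof
    show "n * M \<le> p \<and> p < Suc n * M" if "p div M = n"
      using that div_times_less_eq_dividend[of p M] dividend_less_div_times[OF M(1), of p] by auto
    show "p div M = n" if "n * M \<le> p \<and> p < Suc n * M"
      using that by (intro div_nat_eqI) (simp_all add: mult.commute)
  qed
  have kn: "k * s div M = n" unfolding node using ks s by linarith
  have ksR: "k * s < R" using ks n s by linarith
  show ?thesis
  proof (intro equalityI subsetI)
    fix e assume "e \<in> {e. e < R \<and> e div M = n \<and> e < X \<and> yr e < Y}"
    then have e: "e < R" "e div M = n" "e < X" "yr e < Y" by auto
    have pn: "pos M e div M = n" using pos_div[OF M(1,2) e(1)] e(2) by simp
    have "pos M e < k * s + s"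
    proof (rule ccontr)
      assume a: "\<not> pos M e < k * s + s"
      have "k + 1 \<noteq> n * B + B"
      proof
        assume "k + 1 = n * B + B"
        then have "(k + 1) * s = (n * B + B) * s" by (rule arg_cong)
        then have "k * s + s = Suc n * M" by (simp add: M(3) algebra_simps)
        then show False using a pn node[of "pos M e"] by simp
      qed
      then have Y: "Y \<le> yr (el M ((k + 1) * s))" using hi by blast
      let ?p = "(k + 1) * s"
      have p: "?p \<le> pos M e" using a by (simp add: algebra_simps)
      have pR: "?p < R" using p pos_less[OF M(1,2) e(1)] by simp
      have "?p div M = n" using node[of ?p] node[of "pos M e"] pn p ks by (simp add: algebra_simps)
      then have "el M ?p div M = e div M" using el_div[OF M(1,2) pR] e(2) by simp
      moreover have "\<not> pos M e < pos M (el M ?p)" using p pos_el[OF M(1,2) pR] by simp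
      ultimately have "\<not> yr e < yr (el M ?p)"
        using pos_less_iff[OF M(1,2) e(1) el_less[OF M(1,2) pR]] by simp
      then show False using Y e(4) by simp
    qed
    then show "e \<in> {e. e < R \<and> e div M = k * s div M \<and> pos M e < k * s} \<union>
      {e. e < R \<and> k * s \<le> pos M e \<and> pos M e < k * s + s \<and> e < X \<and> yr e < Y}"
      using e kn by auto
  next
    fix e assume "e \<in> {e. e < R \<and> e div M = k * s div M \<and> pos M e < k * s} \<union>
      {e. e < R \<and> k * s \<le> pos M e \<and> pos M e < k * s + s \<and> e < X \<and> yr e < Y}"
    then consider "e < R" "e div M = n" "pos M e < k * s"
      | "e < R" "k * s \<le> pos M e" "pos M e < k * s + s" "e < X" "yr e < Y" using kn by auto
    then show "e \<in> {e. e < R \<and> e div M = n \<and> e < X \<and> yr e < Y}"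
    proof cases
      case 1
      \<comment> \<open>A nonempty prefix means that \<open>k\<close> is not the first sample of the
        node; then \<open>M = s\<close> is excluded and the whole node lies left of
        \<open>X\<close>.\<close>
      have "pos M e div M = n" using 1 pos_div[OF M(1,2)] by simp
      then have "n * M < k * s" using 1 node[of "pos M e"] by simp
      then have kne: "k \<noteq> n * B" by (auto simp: M(3) mult.assoc)
      then have "M \<noteq> s" using k M s by auto
      then have "Suc n * M \<le> X" using X by simp
      then have "e < X" using node[of e] 1(2) by simp
      moreover have "yr e < yr (el M (k * s))"
        using pos_less_iff[OF M(1,2) 1(1) el_less[OF M(1,2) ksR]] el_div[OF M(1,2) ksR] kn 1
          pos_el[OF M(1,2) ksR] by simp
      ultimately show ?thesis using 1 lo kne by auto
    next
      case 2
      then have "pos M e div M = n" using node[of "pos M e"] ks by linarith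
      then show ?thesis using 2 pos_div[OF M(1,2)] by simp
    qed
  qed
qed

end

lemma card_keys_bij:
  fixes key :: "'a \<Rightarrow> nat"
  assumes "finite P" "inj_on key P"
  shows "bij_betw (\<lambda>p. card {p' \<in> P. key p' < key p}) P {..<card P}"
proof -
  let ?f = "\<lambda>p. card {p' \<in> P. key p' < key p}"
  have lt: "?f p < ?f p'" if "p \<in> P" "key p < key p'" for p p'
    using that assms(1) by (intro psubset_card_mono) auto
  have inj: "inj_on ?f P"
  proof (rule inj_onI)
    fix p p' assume p: "p \<in> P" "p' \<in> P" "?f p = ?f p'"
    then have "\<not> key p < key p'" "\<not> key p' < key p" using lt[of p p'] lt[of p' p] by auto
    then show "p = p'" using inj_onD[OF assms(2) _ p(1,2)] by simp
  qed
  have "?f p < card P" if "p \<in> P" for p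
    using that assms(1) by (intro psubset_card_mono) auto
  then have "?f ` P \<subseteq> {..<card P}" by blast
  from card_subset_eq[OF finite_lessThan this] card_image[OF inj] have "?f ` P = {..<card P}" by simp
  then show ?thesis using inj by (simp add: bij_betw_def)
qed

text \<open>\<open>\<phi>\<close> holds on an initial segment of the key order, so its cardinality
  is the threshold that decides \<open>\<phi>\<close> by rank.\<close>

lemma card_keys_less_iff:
  fixes key :: "'a \<Rightarrow> nat"
  assumes "finite P" "p \<in> P" "\<And>p p'. p \<in> P \<Longrightarrow> p' \<in> P \<Longrightarrow> \<phi> p \<Longrightarrow> \<not> \<phi> p' \<Longrightarrow> key p < key p'"
  shows "card {p' \<in> P. key p' < key p} < card {p' \<in> P. \<phi> p'} \<longleftrightarrow> \<phi> p"
proof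
  assume "\<phi> p"
  then have "{p' \<in> P. key p' < key p} \<subset> {p' \<in> P. \<phi> p'}"
    using assms(2,3) by (auto dest: order_less_asym)
  then show "card {p' \<in> P. key p' < key p} < card {p' \<in> P. \<phi> p'}"
    using assms(1) by (intro psubset_card_mono) auto
next
  assume l: "card {p' \<in> P. key p' < key p} < card {p' \<in> P. \<phi> p'}"
  show "\<phi> p"
  proof (rule ccontr)
    assume "\<not> \<phi> p"
    then have "{p' \<in> P. \<phi> p'} \<subseteq> {p' \<in> P. key p' < key p}" using assms(2,3) by auto
    then have "card {p' \<in> P. \<phi> p'} \<le> card {p' \<in> P. key p' < key p}"
      using assms(1) by (intro card_mono) auto
    then show False using l by simp
  qed
qed

context comm_group
begin

text \<open>Inclusion and exclusion for four quadrants: the strip \<open>?S\<close> below the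
  rectangle and the part left of it each occur once with either sign.\<close>

lemma finprod_rect:
  fixes yr :: "nat \<Rightarrow> nat" and X X' :: nat
  assumes v: "v \<in> {..<X'} \<rightarrow> carrier G" and X: "X \<le> X'" and Y: "Y \<le> Y'"
  shows "finprod G v {e. e < X' \<and> yr e < Y'} \<otimes> inv (finprod G v {e. e < X \<and> yr e < Y'})
     \<otimes> inv (finprod G v {e. e < X' \<and> yr e < Y}) \<otimes> finprod G v {e. e < X \<and> yr e < Y}
   = finprod G v {e. X \<le> e \<and> e < X' \<and> Y \<le> yr e \<and> yr e < Y'}"
proof -
  let ?D = "\<lambda>X Y. finprod G v {e. e < X \<and> yr e < Y}"
  let ?S = "finprod G v {e. X \<le> e \<and> e < X' \<and> yr e < Y}"
  let ?Z = "finprod G v {e. X \<le> e \<and> e < X' \<and> Y \<le> yr e \<and> yr e < Y'}"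
  have cl: "finprod G v A \<in> carrier G" if "A \<subseteq> {..<X'}" for A
    using that v by (intro finprod_closed) auto
  have un: "finprod G v (A \<union> B) = finprod G v A \<otimes> finprod G v B"
    if "A \<subseteq> {..<X'}" "B \<subseteq> {..<X'}" "A \<inter> B = {}" for A B
    using that v finite_subset[OF that(1)] finite_subset[OF that(2)]
    by (intro finprod_Un_disjoint) auto
  have "?D X' Y' = finprod G v (({e. X \<le> e \<and> e < X' \<and> Y \<le> yr e \<and> yr e < Y'} \<union>
      {e. X \<le> e \<and> e < X' \<and> yr e < Y}) \<union> {e. e < X \<and> yr e < Y'})"
    using X Y by (intro arg_cong[of _ _ "finprod G v"]) auto
  also have "\<dots> = ?Z \<otimes> ?S \<otimes> ?D X Y'" using X
    by (subst un, (auto)[3], subst un) auto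
  finally have 1: "?D X' Y' = ?Z \<otimes> ?S \<otimes> ?D X Y'" .
  have "?D X' Y = finprod G v ({e. X \<le> e \<and> e < X' \<and> yr e < Y} \<union> {e. e < X \<and> yr e < Y})"
    using X Y by (intro arg_cong[of _ _ "finprod G v"]) auto
  also have "\<dots> = ?S \<otimes> ?D X Y" using X by (subst un) auto
  finally have 2: "?D X' Y = ?S \<otimes> ?D X Y" .
  have c: "?Z \<in> carrier G" "?S \<in> carrier G" "?D X Y \<in> carrier G" "?D X Y' \<in> carrier G"
    using X by (auto intro!: cl)
  have 3: "inv (?S \<otimes> ?D X Y) \<otimes> ?D X Y = inv ?S"
    using c by (simp add: m_comm[of ?S] inv_mult_group m_assoc)
  have "?Z \<otimes> ?S \<otimes> ?D X Y' \<otimes> inv (?D X Y') = ?Z \<otimes> ?S" using c by (simp add: m_assoc)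
  then show ?thesis unfolding 1 2 using c 3 by (simp add: m_assoc)
qed

end

section \<open>The query program and the stored table\<close>

abbreviation (input) "rZERO \<equiv> 4 :: nat"
abbreviation (input) "rONE \<equiv> 5 :: nat"
abbreviation (input) "rS \<equiv> 6 :: nat"
abbreviation (input) "rBLK \<equiv> 7 :: nat"
abbreviation (input) "rFAN \<equiv> 8 :: nat"
abbreviation (input) "rX \<equiv> 9 :: nat"
abbreviation (input) "rY \<equiv> 10 :: nat"
abbreviation (input) "rACC \<equiv> 11 :: nat"
abbreviation (input) "rRES \<equiv> 12 :: nat"
abbreviation (input) "rZ \<equiv> 13 :: nat"
abbreviation (input) "rLO \<equiv> 14 :: nat"
abbreviation (input) "rN \<equiv> 15 :: nat"
abbreviation (input) "rLV \<equiv> 16 :: nat"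
abbreviation (input) "rG \<equiv> 17 :: nat"
abbreviation (input) "rT \<equiv> 18 :: nat"
abbreviation (input) "rP \<equiv> 19 :: nat"
abbreviation (input) "rPE \<equiv> 20 :: nat"
abbreviation (input) "rJ \<equiv> 21 :: nat"
abbreviation (input) "rF \<equiv> 22 :: nat"
abbreviation (input) "rA \<equiv> 23 :: nat"
abbreviation (input) "rB \<equiv> 24 :: nat"
abbreviation (input) "rC \<equiv> 25 :: nat"
abbreviation (input) "rTMP \<equiv> 26 :: nat"

text \<open>The table is stored row by row; \<open>rS\<close> holds the length of a row.\<close>

definition ld :: "nat \<Rightarrow> nat \<Rightarrow> nat \<Rightarrow> instr list" where
  "ld t k col = [Arith Mul t k rS, Const rTMP col, Arith Add t t rTMP, Load t t]"

lemma length_ld [simp]: "length (ld t k col) = 4"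
  by (simp add: ld_def)

lemma dest_ld [simp]: "i \<in> set (ld t k col) \<Longrightarrow> \<exists>x. dest i = Some x"
  by (auto simp: ld_def)

text \<open>The stored word splits into the offset in the chunk (\<open>rB\<close>) and the child
  label (\<open>rA\<close>); label, chunk number and level give the row of the base, to which the
  offset is added.\<close>

definition jump_code :: "instr list" where
  "jump_code =
     ld rA rJ 12 @ [Arith Mul rB rF rS, Arith Add rB rB rA, Load rB rB] @
     ld rA rJ 13 @ [Arith Div rB rB rA] @
     ld rC rJ 14 @ [Arith Div rA rB rC, Arith Mod rB rB rC, Arith Div rF rF rC] @
     ld rC rJ 15 @ [Arith Mod rA rA rC, Arith Mul rF rF rC, Arith Add rF rF rA] @
     ld rC rJ 16 @ [Arith Add rF rF rC] @
     ld rA rF 8 @ [Arith Add rF rA rB] @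
     ld rJ rJ 11"

definition track :: com where
  "track = WhileLess rZERO rJ (Blk jump_code)"

definition visit :: com where
  "visit = Blk [Move rF rP, Move rJ rLV] ;; track ;; Blk (ld rA rF 5 @ ld rB rF 6) ;;
     IfLess rA rX (IfLess rB rY (Blk (ld rC rF 7 @ [GAdd rACC rACC rC]))) ;;
     Blk [Arith Add rP rP rONE]"

definition scan :: com where
  "scan = WhileLess rP rPE visit"

text \<open>\<open>rT\<close> counts the remaining candidates, always a power of two, and
  \<open>rG\<close> is the table row of the first of them.\<close>

definition bsearch :: com where
  "bsearch = WhileLess rONE rT
     (Blk ([Const rC 2, Arith Div rT rT rC, Arith Add rA rG rT] @ ld rB rA 10) ;;
      IfLess rB rY (Blk [Move rG rA]))"

text \<open>Columns 17 and 16 give the samples per node and the first row of the level, so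
  \<open>rG\<close> starts at the first sample of the node. Removing the level offset from the row
  found and scaling by the block length yields a position.\<close>

definition node :: com where
  "node = Blk ([Arith Sub rN rN rONE] @ ld rT rLV 17 @ ld rA rLV 16 @
       [Arith Mul rG rN rT, Arith Add rG rG rA]) ;;
     bsearch ;;
     Blk (ld rA rG 9 @ [GAdd rACC rACC rA] @ ld rA rLV 16 @
       [Arith Sub rP rG rA, Arith Mul rP rP rBLK, Arith Add rPE rP rBLK]) ;;
     scan"

text \<open>\<open>rN\<close> is the node at which the part already summed begins. Lowering it to
  \<open>rLO\<close>, a multiple of the fan-out, leaves a union of whole nodes of the next
  level.\<close>

definition level :: com where
  "level = Blk [Arith Div rZ rZ rFAN, Arith Mul rLO rZ rFAN] ;; WhileLess rLO rN node ;;
     Blk [Move rN rZ, Arith Add rLV rLV rONE]"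

text \<open>
  On level 0 the loop starts one node further to the right, at the node that contains the boundary
  \<open>rX\<close> itself; this is the only node for which the test against \<open>rX\<close> in \<open>visit\<close> matters.
\<close>

definition dominance :: com where
  "dominance = Blk [GZero rACC, Const rLV 0, Arith Div rZ rX rBLK, Arith Add rN rZ rONE] ;;
     WhileLess rZERO rN level"

text \<open>
  The columns 3 and 4 count coordinates up to and including the row index, hence the decrements of
  the lower ends.
\<close>

definition query :: com where
  "query =
     Blk ([Const rONE 1, Load rS rZERO, Const rA 1, Load rBLK rA, Const rA 2, Load rFAN rA,
       Arith Sub 0 0 rONE, Arith Sub 2 2 rONE] @ ld rX 1 3 @ ld rY 3 4) ;; dominance ;;
     Blk ([Move rRES rACC] @ ld rX 0 3) ;; dominance ;;
     Blk ([GInv rACC rACC, GAdd rRES rRES rACC] @ ld rX 1 3 @ ld rY 2 4) ;; dominance ;;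
     Blk ([GInv rACC rACC, GAdd rRES rRES rACC] @ ld rX 0 3) ;; dominance ;;
     Blk [GAdd 0 rRES rACC]"

lemma writes_Blk_append: "writes (Blk (xs @ ys)) = writes (Blk xs) \<union> writes (Blk ys)"
  by (induction xs) (auto simp: List.map_filter_simps split: option.splits)

lemma writes_ld: "writes (Blk (ld t k col)) = {t, rTMP}"
  by (auto simp: ld_def List.map_filter_simps)

lemma writes_Cons: "writes (Blk (i # is)) = (case dest i of None \<Rightarrow> {} | Some x \<Rightarrow> {x}) \<union> writes (Blk is)"
  by (auto simp: List.map_filter_simps split: option.splits)

lemma writes_Nil: "writes (Blk []) = {}"
  by (simp add: List.map_filter_simps)

lemmas writes_lemmas = writes_Blk_append writes_ld writes_Cons writes_Nil

lemma writes_jump: "writes (Blk jump_code) = {rA, rB, rC, rF, rJ, rTMP}"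
  unfolding jump_code_def writes_lemmas by auto

lemma writes_track: "writes track = {rA, rB, rC, rF, rJ, rTMP}"
  unfolding track_def by (simp add: writes_jump del: writes.simps(1))

lemma writes_visit: "writes visit = {rACC, rP, rA, rB, rC, rF, rJ, rTMP}"
  by (simp add: visit_def writes_track writes_lemmas del: writes.simps(1)) auto

lemma writes_scan: "writes scan = {rACC, rP, rA, rB, rC, rF, rJ, rTMP}"
  by (simp add: scan_def writes_visit)

lemma writes_bsearch: "writes bsearch = {rC, rT, rA, rB, rG, rTMP}"
  by (simp add: bsearch_def writes_lemmas del: writes.simps(1)) auto

lemma writes_node: "writes node = {rN, rT, rG, rPE, rACC, rP, rA, rB, rC, rF, rJ, rTMP}"
  by (simp add: node_def writes_bsearch writes_scan writes_lemmas del: writes.simps(1)) auto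

lemma writes_level:
  "writes level = {rZ, rLO, rLV, rN, rT, rG, rPE, rACC, rP, rA, rB, rC, rF, rJ, rTMP}"
  by (simp add: level_def writes_node writes_lemmas del: writes.simps(1)) auto

lemma writes_dominance:
  "writes dominance = {rZ, rLO, rLV, rN, rT, rG, rPE, rACC, rP, rA, rB, rC, rF, rJ, rTMP}"
  by (simp add: dominance_def writes_level writes_lemmas del: writes.simps(1)) auto

section \<open>The stored table and its bit fields\<close>

locale tree = ranked "2 ^ K" yr + comm_group G
  for K :: nat and yr :: "nat \<Rightarrow> nat" and G :: "nat monoid" (structure) +
  fixes w \<sigma> d N :: nat and v cx cy :: "nat \<Rightarrow> nat"
  assumes carrier: "carrier G = {..<N}" and N: "N \<le> 2 ^ w"
    and K: "0 < K" "\<sigma> \<le> K" "K < 2 ^ \<sigma>" "3 * K \<le> w" and d: "0 < d" "d < w"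
    and yr: "e < 2 ^ K \<Longrightarrow> yr e < 2 ^ K"
    and v: "v \<in> {..<2 ^ K} \<rightarrow> carrier G"
    and counts: "cx k < 2 ^ K" "cy k < 2 ^ K"
begin

definition lev :: "nat \<Rightarrow> nat" where "lev i = 2 ^ (\<sigma> + i * d)"

definition height :: nat where "height = Suc ((K - \<sigma>) div d)"

definition down :: "nat \<Rightarrow> nat" where "down i = i - stp (2 ^ d) i"

definition fan :: "nat \<Rightarrow> nat" where "fan i = 2 ^ (d * stp (2 ^ d) i)"

text \<open>This is \<open>2 ^ \<sigma>\<close> times \<open>fan i\<close>, which makes the pairs of
  a chunk and a child number \<open>2 ^ (K - \<sigma>)\<close> on each level.\<close>

definition chunk :: "nat \<Rightarrow> nat" where "chunk i = 2 ^ (\<sigma> + d * stp (2 ^ d) i)"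

definition label :: "nat \<Rightarrow> nat \<Rightarrow> nat" where "label i e = e div lev (down i) mod fan i"

text \<open>The width of an offset below \<open>chunk i\<close> plus that of a label below
  \<open>fan i\<close>. Level 0 is singled out because no jump leaves it, while \<open>stp\<close>
  has the default value 1 there.\<close>

definition bits :: "nat \<Rightarrow> nat" where
  "bits i = (if i = 0 then 0 else \<sigma> + d * stp (2 ^ d) i + d * stp (2 ^ d) i)"

definition off :: "nat \<Rightarrow> nat" where "off i = (\<Sum>j<i. bits j)"

definition field :: "nat \<Rightarrow> nat \<Rightarrow> nat" where
  "field p i = (if i = 0 then 0 else label i (el (lev i) p) * chunk i
     + rnk (lev i) (lev (down i)) (chunk i) (el (lev i) p))"

text \<open>
  The fields of a position form one long number, stored as overlapping windows of \<open>3 * K\<close> bits at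
  the multiples of \<open>K\<close>, so that every field lies inside a single window.
\<close>

definition packed :: "nat \<Rightarrow> nat" where
  "packed p = (SOME W. \<forall>i<height. (W div 2 ^ off i) mod 2 ^ bits i = field p i)"

text \<open>Columns 0 to 17, followed by windows numbered from 0 to \<open>off height div K\<close>;
  the latter bounds the window number of every field.\<close>

definition stride :: nat where "stride = 19 + off height div K"

definition prefix :: "nat \<Rightarrow> nat \<Rightarrow> nat" where
  "prefix i k = finprod G v
     {e. e < 2 ^ K \<and> e div lev i = k * 2 ^ \<sigma> div lev i \<and> pos (lev i) e < k * 2 ^ \<sigma>}"

text \<open>
  The row index means a coordinate in columns 3 and 4, a position on level 0 in columns 5 to
  7, chunk \<open>\<kappa>\<close> or sample \<open>\<kappa>\<close> of level \<open>i\<close> in columns 8 to 10, a level in columns 11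
  to 17, and a position on an arbitrary level in the remaining ones.  Out of range these entries
  are junk that is never read.
\<close>

definition cell :: "nat \<Rightarrow> nat \<Rightarrow> nat" where
  "cell k col = (let i = k div 2 ^ (K - \<sigma>); \<kappa> = k mod 2 ^ (K - \<sigma>) in
     if col = 0 then stride
     else if col = 1 then 2 ^ \<sigma>
     else if col = 2 then 2 ^ d
     else if col = 3 then cx k
     else if col = 4 then cy k
     else if col = 5 then el (lev 0) k
     else if col = 6 then yr (el (lev 0) k)
     else if col = 7 then v (el (lev 0) k)
     else if col = 8 then
       base (lev i) (lev (down i)) (fan i) (chunk i) (\<kappa> div fan i) (\<kappa> mod fan i)
     else if col = 9 then prefix i \<kappa>
     else if col = 10 then yr (el (lev i) (\<kappa> * 2 ^ \<sigma>))
     else if col = 11 then down k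
     else if col = 12 then 18 + off k div K
     else if col = 13 then 2 ^ (off k mod K)
     else if col = 14 then chunk k
     else if col = 15 then fan k
     else if col = 16 then k * 2 ^ (K - \<sigma>)
     else if col = 17 then 2 ^ (k * d)
     else packed k div 2 ^ (K * (col - 18)) mod 2 ^ (3 * K))"

lemma fan2: "2 \<le> (2 :: nat) ^ d"
  using d by (cases d) auto

lemma height_le: "height \<le> 2 ^ \<sigma>" "height \<le> K + 1"
proof -
  have "(K - \<sigma>) div d \<le> K" by (rule order_trans[OF div_le_dividend diff_le_self])
  then show "height \<le> 2 ^ \<sigma>" "height \<le> K + 1" using K by (auto simp: height_def)
qed

lemma level_exp: "i < height \<Longrightarrow> \<sigma> + i * d \<le> K"
proof -
  assume "i < height"
  then have "i * d \<le> (K - \<sigma>) div d * d" by (intro mult_le_mono1) (simp add: height_def)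
  also have "\<dots> \<le> K - \<sigma>" by simp
  finally show ?thesis using K by simp
qed

lemma lev_dvd: "i < height \<Longrightarrow> lev i dvd 2 ^ K"
  using level_exp by (simp add: lev_def le_imp_power_dvd)

lemma lev_pos [simp]: "0 < lev i"
  by (simp add: lev_def)

text \<open>On the fictitious level \<open>height\<close> every boundary falls into node 0, which
  stops the climb.\<close>

lemma lev_height: "2 ^ K < lev height"
proof -
  have "K - \<sigma> < d * Suc ((K - \<sigma>) div d)" using d dividend_less_times_div by simp
  then have "K < \<sigma> + height * d" unfolding height_def by (simp add: mult.commute)
  then show ?thesis by (simp add: lev_def)
qed

lemma powR: "2 ^ K = (2 :: nat) ^ \<sigma> * 2 ^ (K - \<sigma>)"
  using K by (simp flip: power_add)

lemma level_row:
  assumes "i < height" "k < 2 ^ (K - \<sigma>)"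
  shows "i * 2 ^ (K - \<sigma>) + k < 2 ^ K"
proof -
  have "Suc i * 2 ^ (K - \<sigma>) \<le> 2 ^ \<sigma> * 2 ^ (K - \<sigma>)" using assms height_le by (intro mult_le_mono1) simp
  then show ?thesis using assms(2) powR by simp
qed

lemma height_less: "i < height \<Longrightarrow> i < 2 ^ K"
  using height_le power_increasing[of \<sigma> K "2 :: nat"] K by linarith

context
  fixes i assumes i: "0 < i" "i < height"
begin

lemma stp_bounds: "0 < stp (2 ^ d) i" "stp (2 ^ d) i \<le> i"
  using stp_pos stp_le i fan2 by auto

lemma stp_exp_le: "d * stp (2 ^ d) i \<le> i * d"
  using mult_le_mono2[OF stp_bounds(2), of d] by (simp only: mult.commute)

lemma lev_eq: "lev i = lev (down i) * fan i"
proof -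
  obtain j where j: "i = stp (2 ^ d) i + j" using stp_bounds(2) by (auto simp: le_iff_add)
  then have "\<sigma> + i * d = \<sigma> + j * d + d * stp (2 ^ d) i" by (metis add.assoc add.commute add_mult_distrib mult.commute)
  moreover have "down i = j" using j by (simp add: down_def)
  ultimately show ?thesis by (simp add: lev_def fan_def flip: power_add)
qed

lemma stp_exp: "\<sigma> + d * stp (2 ^ d) i \<le> K"
  using stp_exp_le level_exp[OF i(2)] by linarith

lemma chunk_dvd: "chunk i dvd lev i"
  using stp_exp_le by (simp add: chunk_def lev_def le_imp_power_dvd)

lemma field_less:
  assumes "p < 2 ^ K"
  shows "field p i < 2 ^ bits i"
proof -
  have e: "el (lev i) p < 2 ^ K" using el_less[OF _ lev_dvd[OF i(2)] assms] by simp
  have "label i (el (lev i) p) < fan i" by (simp add: label_def fan_def)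
  then have "Suc (label i (el (lev i) p)) * chunk i \<le> fan i * chunk i" by (intro mult_le_mono1) simp
  moreover have "rnk (lev i) (lev (down i)) (chunk i) (el (lev i) p) < chunk i"
    using pos_jump(2)[OF _ lev_dvd[OF i(2)] lev_eq _ chunk_dvd e] by (simp add: chunk_def)
  moreover have "fan i * chunk i = 2 ^ bits i"
    using i by (simp add: fan_def chunk_def bits_def algebra_simps flip: power_add)
  ultimately show ?thesis using i by (simp add: field_def)
qed

end

lemma packed_field:
  assumes "p < 2 ^ K" "i < height"
  shows "(packed p div 2 ^ off i) mod 2 ^ bits i = field p i"
proof -
  have "field p j < 2 ^ bits j" if "j < height" for j
    using field_less[of j p] that assms by (cases "j = 0") (simp_all add: field_def bits_def)
  from packing[of height "field p" bits, OF this]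
  have "\<exists>W. \<forall>i<height. (W div 2 ^ off i) mod 2 ^ bits i = field p i" unfolding off_def by blast
  from someI_ex[OF this] show ?thesis using assms unfolding packed_def by blast
qed

lemma bits_le: "i < height \<Longrightarrow> bits i \<le> 2 * K"
  using stp_exp[of i] by (cases "i = 0") (simp_all add: bits_def)

text \<open>A field starts within the first \<open>K\<close> bits of window
  \<open>off i div K\<close> and has at most \<open>2 * K\<close> bits, since \<sigma> plus the bits
  of one label is at most \<open>K\<close>. This is the origin of the window length
  \<open>3 * K\<close>.\<close>

lemma word_field:
  assumes "p < 2 ^ K" "i < height"
  shows "cell p (18 + off i div K) div 2 ^ (off i mod K) mod 2 ^ bits i = field p i"
proof -
  have "off i mod K + bits i \<le> 3 * K"
    using bits_le[OF assms(2)] mod_less_divisor[OF K(1), of "off i"] by simp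
  from window[OF this, of "packed p" "K * (off i div K)"] show ?thesis
    using packed_field[OF assms] by (simp add: cell_def)
qed

text \<open>\<open>x\<close> is not masked and may carry fields of further levels in its upper bits.
  As \<open>chunk i * fan i\<close> is \<open>2 ^ bits i\<close>, the two remainders discard
  them.\<close>

lemma word_rank_label:
  assumes "e < 2 ^ K" "0 < i" "i < height"
  defines "x \<equiv> cell (pos (lev i) e) (18 + off i div K) div 2 ^ (off i mod K)"
  shows "x mod chunk i = rnk (lev i) (lev (down i)) (chunk i) e"
    and "x div chunk i mod fan i = label i e"
proof -
  note M = lev_pos lev_dvd[OF assms(3)]
  have "x mod 2 ^ bits i = field (pos (lev i) e) i"
    unfolding x_def using word_field[OF pos_less[OF M assms(1)] assms(3)] .
  also have "\<dots> = label i e * chunk i + rnk (lev i) (lev (down i)) (chunk i) e"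
    using assms(2) el_pos[OF M assms(1)] by (simp add: field_def)
  also have "2 ^ bits i = chunk i * fan i"
    using assms(2) by (simp add: bits_def chunk_def fan_def power_add)
  finally have x: "x mod (chunk i * fan i) = label i e * chunk i + rnk (lev i) (lev (down i)) (chunk i) e" .
  have r: "rnk (lev i) (lev (down i)) (chunk i) e < chunk i"
    using pos_jump(2)[OF M lev_eq _ chunk_dvd assms(1)] assms by (simp add: chunk_def)
  have "x mod chunk i = x mod (chunk i * fan i) mod chunk i" by (simp add: mod_mult2_eq)
  then show "x mod chunk i = rnk (lev i) (lev (down i)) (chunk i) e" using x r by simp
  have "x div chunk i mod fan i = x mod (chunk i * fan i) div chunk i"
    using r by (simp add: mod_mult2_eq chunk_def)
  then show "x div chunk i mod fan i = label i e" using x r by simp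
qed

end

section \<open>Correctness and running time of the query\<close>

locale loaded = tree +
  fixes m :: "nat \<Rightarrow> nat"
  assumes size: "2 ^ K * stride \<le> 2 ^ w"
    and cells: "k < 2 ^ K \<Longrightarrow> col < stride \<Longrightarrow> m (k * stride + col) = cell k col mod 2 ^ w"
begin

abbreviation run :: "com \<Rightarrow> (nat \<Rightarrow> nat) \<Rightarrow> nat \<Rightarrow> ((nat \<Rightarrow> nat) \<Rightarrow> bool) \<Rightarrow> bool" where
  "run \<equiv> ev w G m"

lemma pow_K_w: "2 ^ K \<le> (2 :: nat) ^ w"
  using K by (intro power_increasing) auto

lemma pow_K_less_w: "(2 :: nat) ^ K < 2 ^ w"
  using K by (intro power_strict_increasing) auto

lemma less_word: "(x :: nat) < 2 ^ K \<Longrightarrow> x < 2 ^ w"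
  using pow_K_w by linarith

lemma addr:
  assumes "k < 2 ^ K" "col < stride"
  shows "k * stride + col < 2 ^ w" "k * stride < 2 ^ w"
proof -
  have "Suc k * stride \<le> 2 ^ K * stride" using assms by (intro mult_le_mono1) simp
  then show "k * stride + col < 2 ^ w" "k * stride < 2 ^ w" using assms(2) size by auto
qed

lemma stride_gt: "col < 19 \<Longrightarrow> col < stride"
  by (simp add: stride_def)

lemma fold_ld:
  assumes "s rS = stride" "s k < 2 ^ K" "col < 19" "t \<noteq> rS" "t \<noteq> rTMP"
  shows "fold (isem w G m) (ld t k col) s = s(rTMP := col, t := cell (s k) col mod 2 ^ w)"
proof -
  have c: "col < stride" using assms(3) stride_gt by simp
  have "(32::nat) \<le> 2 ^ w" if "5 \<le> w" using power_increasing[of 5 w "2::nat"] that by simp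
  moreover have "col < 2 ^ w" using addr(1)[OF assms(2) c] by simp
  ultimately show ?thesis
    using assms addr[OF assms(2) c] cells[OF assms(2) c] by (auto simp: ld_def fun_eq_iff)
qed

lemma sub_word: "b \<le> a \<Longrightarrow> a < 2 ^ w \<Longrightarrow> (a + 2 ^ w - b) mod 2 ^ w = (a - b :: nat)"
proof -
  assume a: "b \<le> a" "a < 2 ^ w"
  then have eq: "a + 2 ^ w - b = (a - b) + 2 ^ w" by simp
  show ?thesis unfolding eq mod_add_self2 using a by (intro mod_less) simp
qed

lemma cell_desc:
  assumes "i < height"
  shows "cell i 11 mod 2 ^ w = down i" "cell i 12 mod 2 ^ w = 18 + off i div K"
    "cell i 13 mod 2 ^ w = 2 ^ (off i mod K)" "cell i 16 mod 2 ^ w = i * 2 ^ (K - \<sigma>)"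
    "cell i 17 mod 2 ^ w = 2 ^ (i * d)"
    "0 < i \<Longrightarrow> cell i 14 mod 2 ^ w = chunk i" "0 < i \<Longrightarrow> cell i 15 mod 2 ^ w = fan i"
    "18 + off i div K < stride"
proof -
  have i: "i < 2 ^ K" using height_less assms by simp
  show "cell i 11 mod 2 ^ w = down i" using less_word[of "down i"] i by (simp add: cell_def down_def)
  have "off i \<le> off height" unfolding off_def using assms by (intro sum_mono2) auto
  then have "off i div K \<le> off height div K" by (rule div_le_mono)
  then show lt: "18 + off i div K < stride" by (simp add: stride_def)
  then show "cell i 12 mod 2 ^ w = 18 + off i div K" using addr(1)[OF i lt] by (simp add: cell_def)
  have lw: "(2 :: nat) ^ a < 2 ^ w" if "a \<le> K" for a
    using that K by (intro power_strict_increasing) auto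
  show "cell i 13 mod 2 ^ w = 2 ^ (off i mod K)"
    using lw[of "off i mod K"] mod_less_divisor[OF K(1), of "off i"] by (simp add: cell_def)
  show "cell i 16 mod 2 ^ w = i * 2 ^ (K - \<sigma>)"
    using less_word[OF level_row[OF assms, of 0]] by (simp add: cell_def)
  show "cell i 17 mod 2 ^ w = 2 ^ (i * d)"
    using lw[of "i * d"] level_exp[OF assms] by (simp add: cell_def)
  show "cell i 14 mod 2 ^ w = chunk i" if "0 < i"
    using lw stp_exp[OF that assms] by (simp add: cell_def chunk_def)
  show "cell i 15 mod 2 ^ w = fan i" if "0 < i"
    using lw[of "d * stp (2 ^ d) i"] stp_exp[OF that assms] by (simp add: cell_def fan_def)
qed

text \<open>The mathematics is \<open>pos_jump\<close>; what remains is that no intermediate value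
  overflows a word and that every row read lies inside the table.\<close>

lemma jump_step:
  assumes s: "s rS = stride" "s rJ = i" "0 < i" "i < height" "s rF = pos (lev i) e" "e < 2 ^ K"
  defines "s' \<equiv> fold (isem w G m) jump_code s"
  shows "s' rJ = down i" "s' rF = pos (lev (down i)) e"
proof -
  note M = lev_pos lev_dvd[OF s(4)]
  define p where "p = pos (lev i) e"
  define RS where "RS = (2 :: nat) ^ (K - \<sigma>)"
  have i: "i < 2 ^ K" using height_less s(4) by simp
  have p: "p < 2 ^ K" unfolding p_def using pos_less[OF M s(6)] .
  have dn: "down i < height" using s(4) by (simp add: down_def)
  define W where "W = cell p (18 + off i div K)"
  have W: "W < 2 ^ w"
  proof -
    have "W < 2 ^ (3 * K)" by (simp add: W_def cell_def)
    also have "\<dots> \<le> 2 ^ w" using K by (intro power_increasing) auto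
    finally show ?thesis .
  qed
  have mW: "m (p * stride + (18 + off i div K)) = W"
    using cells[OF p cell_desc(8)[OF s(4)]] W by (simp add: W_def)
  have a: "p * stride < 2 ^ w" "p * stride + (18 + off i div K) < 2 ^ w"
    using addr[OF p cell_desc(8)[OF s(4)]] by auto
  define x where "x = W div 2 ^ (off i mod K)"
  have x: "x mod chunk i = rnk (lev i) (lev (down i)) (chunk i) e" "x div chunk i mod fan i = label i e"
    using word_rank_label[OF s(6,3,4)] unfolding x_def W_def p_def by auto
  let ?c = "chunk i" and ?E = "fan i"
  have c0: "0 < ?c" and E0: "0 < ?E" by (simp_all add: chunk_def fan_def)
  have l: "label i e < ?E" using E0 by (simp add: label_def)
  have RS: "2 ^ K = 2 ^ \<sigma> * RS" using powR by (simp add: RS_def)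
  have cE: "?c = 2 ^ \<sigma> * ?E" by (simp add: chunk_def fan_def power_add)
  \<comment> \<open>A level has \<open>t\<close> chunks with \<open>?E\<close> children each, so
    chunk number and label combine to an index below \<open>RS\<close>.\<close>
  obtain t where t: "RS = t * ?E"
  proof -
    have "?E dvd RS" using stp_exp[OF s(3,4)] unfolding fan_def RS_def by (intro le_imp_power_dvd) simp
    then show ?thesis using that by (metis dvd_div_mult_self)
  qed
  have "p div ?c < t"
    using p by (simp add: RS t cE less_mult_imp_div_less mult_ac)
  then have "Suc (p div ?c) * ?E \<le> t * ?E" by (intro mult_le_mono1) simp
  then have k: "p div ?c * ?E + label i e < RS" using l t by simp
  have idx: "i * RS + (p div ?c * ?E + label i e) < 2 ^ K"
    using level_row[OF s(4), folded RS_def, OF k] .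
  have bs: "base (lev i) (lev (down i)) ?E ?c (p div ?c) (label i e) + x mod ?c = pos (lev (down i)) e"
    using pos_jump(1)[OF M lev_eq[OF s(3,4)] c0 chunk_dvd[OF s(3,4)] s(6)] x(1)
    by (simp add: p_def label_def)
  have pd: "pos (lev (down i)) e < 2 ^ K" by (rule pos_less[OF lev_pos lev_dvd[OF dn] s(6)])
  \<comment> \<open>As a summand of the target position the base is below \<open>2 ^ K\<close>, so
    truncation to a word does not alter it.\<close>
  have T: "cell (i * RS + (p div ?c * ?E + label i e)) 8 mod 2 ^ w
      = base (lev i) (lev (down i)) ?E ?c (p div ?c) (label i e)"
    using k l bs less_word[OF pd] by (simp add: cell_def RS_def[symmetric])
  have idx2: "p div ?c * ?E + label i e + i * RS < 2 ^ K" using idx by simp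
  have T2: "cell (p div ?c * ?E + label i e + i * RS) 8 mod 2 ^ w
      = base (lev i) (lev (down i)) ?E ?c (p div ?c) (label i e)"
    using T by (simp add: add_ac)
  have lw: "p div ?c * ?E < 2 ^ w" "p div ?c * ?E + label i e < 2 ^ w"
    "p div ?c * ?E + label i e + i * RS < 2 ^ w"
    "pos (lev (down i)) e < 2 ^ w"
    using idx2 less_word[OF pd] pow_K_w by linarith+
  note desc = cell_desc[OF s(4)]
  have "s' rJ = down i \<and> s' rF = pos (lev (down i)) e"
    unfolding s'_def jump_code_def
    using s(1,2) i a mW desc(6,7)[OF s(3)] x lw idx2 T2 bs s(5)[folded p_def]
    by (simp add: fold_ld desc(1-4) x_def[symmetric] RS_def[symmetric])
  then show "s' rJ = down i" "s' rF = pos (lev (down i)) e" by auto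
qed

definition jmax :: nat where "jmax = Max (dsum (2 ^ d) ` {..<height})"

lemma dsum_le_jmax: "i < height \<Longrightarrow> dsum (2 ^ d) i \<le> jmax"
  unfolding jmax_def by (intro Max_ge) auto

lemma length_jump: "length jump_code = 40"
  by (simp add: jump_code_def ld_def)

lemma dest_jump: "\<forall>i\<in>set jump_code. dest i \<noteq> None"
  by (auto simp: jump_code_def ld_def)

text \<open>The element \<open>e\<close> stays fixed while its level and position change; the
  variant is the digit sum of the level. An iteration takes 40 instructions, the test and the jump
  back.\<close>

lemma run_track:
  assumes "s rS = stride" "s rZERO = 0" "s rJ = i" "i < height" "s rF = pos (lev i) e" "e < 2 ^ K"
  shows "run track s (42 * jmax + 2) (\<lambda>s'. s' rF = pos (lev 0) e)"
  unfolding track_def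
proof (rule ev_While[where T = 40 and n = "dsum (2 ^ d) i" and
      I = "\<lambda>k s'. s' rJ < height \<and> k = dsum (2 ^ d) (s' rJ) \<and> s' rF = pos (lev (s' rJ)) e"])
  show "s rJ < height \<and> dsum (2 ^ d) i = dsum (2 ^ d) (s rJ) \<and> s rF = pos (lev (s rJ)) e"
    using assms by simp
next
  fix k s'
  assume I: "s' rJ < height \<and> k = dsum (2 ^ d) (s' rJ) \<and> s' rF = pos (lev (s' rJ)) e"
    and c: "s' rZERO < s' rJ"
    and fr: "\<forall>z. z \<notin> writes (Blk jump_code) \<longrightarrow> s' z = s z"
  have S: "s' rS = stride" "0 < s' rJ" using fr assms c by (simp_all add: writes_jump del: writes.simps)
  have "fold (isem w G m) jump_code s' rJ = down (s' rJ)"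
      "fold (isem w G m) jump_code s' rF = pos (lev (down (s' rJ))) e"
    using jump_step[OF S(1) refl S(2) _ _ assms(6)] I by auto
  moreover have "Suc (dsum (2 ^ d) (down (s' rJ))) = dsum (2 ^ d) (s' rJ)"
    unfolding down_def by (rule dsum_diff_stp[OF S(2) fan2])
  ultimately show "run (Blk jump_code) s' 40 (\<lambda>s''. \<exists>k'<k. s'' rJ < height \<and>
      k' = dsum (2 ^ d) (s'' rJ) \<and> s'' rF = pos (lev (s'' rJ)) e)"
    using I dest_jump by (intro ev_Blk) (auto simp: length_jump down_def)
next
  fix k s'
  assume "s' rJ < height \<and> k = dsum (2 ^ d) (s' rJ) \<and> s' rF = pos (lev (s' rJ)) e"
    "\<not> s' rZERO < s' rJ" "\<forall>z. z \<notin> writes (Blk jump_code) \<longrightarrow> s' z = s z"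
  then show "s' rF = pos (lev 0) e" using assms(2) by (simp add: writes_jump del: writes.simps)
next
  show "dsum (2 ^ d) i * (40 + 2) + 2 \<le> 42 * jmax + 2" using dsum_le_jmax[OF assms(4)] by simp
qed

lemma v_closed: "e < 2 ^ K \<Longrightarrow> v e \<in> carrier G"
  using v by auto

lemma carrier_word: "a \<in> carrier G \<Longrightarrow> a mod 2 ^ w = a"
  using N by (simp add: carrier)

lemma lev_0: "lev 0 = 2 ^ \<sigma>"
  by (simp add: lev_def)

lemma height_0: "0 < height"
  by (simp add: height_def)

lemma run_visit:
  assumes s: "s rS = stride" "s rZERO = 0" "s rONE = 1" "s rLV = i" "i < height" "s rP = p" "p < 2 ^ K"
    "s rACC \<in> carrier G"
  defines "e \<equiv> el (lev i) p"
  shows "run visit s (42 * jmax + 22) (\<lambda>s'. s' rP = Suc p \<and>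
     s' rACC = (if e < s rX \<and> yr e < s rY then s rACC \<otimes> v e else s rACC))"
proof -
  note M = lev_pos lev_dvd[OF s(5)]
  note M0 = lev_pos lev_dvd[OF height_0]
  have e: "e < 2 ^ K" unfolding e_def by (rule el_less[OF M s(7)])
  define f where "f = pos (lev 0) e"
  have f: "f < 2 ^ K" unfolding f_def by (rule pos_less[OF M0 e])
  have pe: "p = pos (lev i) e" unfolding e_def using pos_el[OF M s(7)] by simp
  have ce: "cell f 5 mod 2 ^ w = e" "cell f 6 mod 2 ^ w = yr e" "cell f 7 mod 2 ^ w = v e"
    using less_word[OF e] less_word[OF yr[OF e]] carrier_word[OF v_closed[OF e]]
    by (simp_all add: cell_def f_def el_pos[OF M0 e])
  have p1: "Suc p mod 2 ^ w = Suc p"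
  proof -
    have "Suc p < 2 ^ w" using s(7) pow_K_less_w by linarith
    then show ?thesis by simp
  qed
  let ?Q = "\<lambda>s'. s' rP = Suc p \<and>
     s' rACC = (if e < s rX \<and> yr e < s rY then s rACC \<otimes> v e else s rACC)"
  let ?add = "IfLess rA rX (IfLess rB rY (Blk (ld rC rF 7 @ [GAdd rACC rACC rC])))"
  let ?inc = "Blk [Arith Add rP rP rONE]"
  have add: "run (?add ;; ?inc) s3 10 ?Q"
    if s3: "s3 rS = stride" "s3 rONE = 1" "s3 rP = p" "s3 rACC = s rACC" "s3 rX = s rX" "s3 rY = s rY"
      "s3 rA = e" "s3 rB = yr e" "s3 rF = f" for s3
  proof (rule ev_Seq[where T = 9 and T' = 1])
    let ?Q' = "\<lambda>s'. s' rACC = (if e < s rX \<and> yr e < s rY then s rACC \<otimes> v e else s rACC)"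
    show "run ?add s3 9 ?Q'"
      by (rule ev_If[where T = 7], rule ev_If[where T = 5], rule ev_Blk)
        (use s3 s(8) f v_closed[OF e] in \<open>auto simp: fold_ld ce\<close>)
    fix s4 assume a: "?Q' s4" and fr: "\<forall>x. x \<notin> writes ?add \<longrightarrow> s4 x = s3 x"
    have "s4 rP = p" "s4 rONE = 1" using fr s3 by (simp_all add: writes_lemmas del: writes.simps(1))
    then show "run ?inc s4 1 ?Q" using a p1 by (intro ev_Blk) auto
  qed simp
  show ?thesis
    unfolding visit_def
  proof (rule ev_Blk_Seq[where T = "42 * jmax + 20"], simp)
    let ?s1 = "fold (isem w G m) [Move rF rP, Move rJ rLV] s"
    show "run (track ;; Blk (ld rA rF 5 @ ld rB rF 6) ;; ?add ;; ?inc) ?s1 (42 * jmax + 20) ?Q"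
    proof (rule ev_Seq[where T' = 18])
      show "run track ?s1 (42 * jmax + 2) (\<lambda>s'. s' rF = f)"
        unfolding f_def by (rule run_track[where i = i]) (use s e pe in auto)
      fix s2 assume F: "s2 rF = f" and fr: "\<forall>x. x \<notin> writes track \<longrightarrow> s2 x = ?s1 x"
      have s2: "s2 rS = stride" "s2 rONE = 1" "s2 rP = p" "s2 rACC = s rACC" "s2 rX = s rX" "s2 rY = s rY"
        using fr s by (simp_all add: writes_track)
      show "run (Blk (ld rA rF 5 @ ld rB rF 6) ;; ?add ;; ?inc) s2 18 ?Q"
        by (rule ev_Blk_Seq[where T = 10], simp add: ball_Un, rule add)
          (use s2 F f in \<open>simp_all add: fold_ld ce\<close>)
    qed simp
  qed simp
qed

lemma fp_closed: "A \<subseteq> {..<2 ^ K} \<Longrightarrow> finprod G v A \<in> carrier G"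
  using v by (intro finprod_closed) auto

lemma fp_union:
  assumes "A \<subseteq> {..<2 ^ K}" "B \<subseteq> {..<2 ^ K}" "A \<inter> B = {}"
  shows "finprod G v (A \<union> B) = finprod G v A \<otimes> finprod G v B"
  using assms v finite_subset[OF assms(1)] finite_subset[OF assms(2)]
  by (intro finprod_Un_disjoint) auto

lemma run_scan:
  assumes s: "s rS = stride" "s rZERO = 0" "s rONE = 1" "s rLV = i" "i < height" "s rP = p"
    "s rPE = p + 2 ^ \<sigma>" "p + 2 ^ \<sigma> \<le> 2 ^ K" "s rACC \<in> carrier G"
  shows "run scan s (2 ^ \<sigma> * (42 * jmax + 24) + 2) (\<lambda>s'. s' rACC = s rACC \<otimes> finprod G v
     {e. e < 2 ^ K \<and> p \<le> pos (lev i) e \<and> pos (lev i) e < p + 2 ^ \<sigma> \<and> e < s rX \<and> yr e < s rY})"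
proof -
  note M = lev_pos lev_dvd[OF s(5)]
  define A where "A p' = {e. e < 2 ^ K \<and> p \<le> pos (lev i) e \<and> pos (lev i) e < p' \<and> e < s rX \<and> yr e < s rY}" for p'
  have A: "A p' \<subseteq> {..<2 ^ K}" for p' by (auto simp: A_def)
  have A0: "A p = {}" by (auto simp: A_def)
  have step: "s rACC \<otimes> finprod G v (A (Suc p')) =
      (if el (lev i) p' < s rX \<and> yr (el (lev i) p') < s rY
       then s rACC \<otimes> finprod G v (A p') \<otimes> v (el (lev i) p') else s rACC \<otimes> finprod G v (A p'))"
    if p': "p \<le> p'" "p' < 2 ^ K" for p'
  proof -
    let ?e = "el (lev i) p'"
    have e: "?e < 2 ^ K" "pos (lev i) ?e = p'" using el_less[OF M p'(2)] pos_el[OF M p'(2)] by auto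
    \<comment> \<open>\<open>el\<close> inverts \<open>pos\<close>, so one more position brings in
      exactly one more element.\<close>
    have eq: "e < 2 ^ K \<and> pos (lev i) e = p' \<longleftrightarrow> e = ?e" for e
      using el_pos[OF M, of e] e by metis
    have "A (Suc p') = A p' \<union> {e. (e < 2 ^ K \<and> pos (lev i) e = p') \<and> e < s rX \<and> yr e < s rY}"
      using p' by (auto simp: A_def less_Suc_eq)
    then have S: "A (Suc p') = A p' \<union> (if ?e < s rX \<and> yr ?e < s rY then {?e} else {})"
      unfolding eq by auto
    show ?thesis
    proof (cases "?e < s rX \<and> yr ?e < s rY")
      case True
      have "finprod G v (A p' \<union> {?e}) = finprod G v (A p') \<otimes> finprod G v {?e}"
        by (rule fp_union) (use A e in \<open>auto simp: A_def\<close>)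
      moreover have "finprod G v {?e} = v ?e" using v_closed[OF e(1)] by simp
      ultimately show ?thesis
        using True s(9) v_closed[OF e(1)] fp_closed[OF A] by (simp add: S m_assoc)
    next
      case False
      show ?thesis unfolding S if_not_P[OF False] by simp
    qed
  qed
  show ?thesis
    unfolding scan_def
  proof (rule ev_While[where T = "42 * jmax + 22" and n = "2 ^ \<sigma>" and
      I = "\<lambda>k s'. \<exists>j\<le>2 ^ \<sigma>. k = 2 ^ \<sigma> - j \<and> s' rP = p + j \<and> s' rACC = s rACC \<otimes> finprod G v (A (p + j))"])
    show "\<exists>j\<le>2 ^ \<sigma>. 2 ^ \<sigma> = 2 ^ \<sigma> - j \<and> s rP = p + j \<and> s rACC = s rACC \<otimes> finprod G v (A (p + j))"
      using s A0 by (intro exI[of _ 0]) simp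
  next
    fix k s'
    assume "\<exists>j\<le>2 ^ \<sigma>. k = 2 ^ \<sigma> - j \<and> s' rP = p + j \<and> s' rACC = s rACC \<otimes> finprod G v (A (p + j))"
      and c: "s' rP < s' rPE" and fr: "\<forall>z. z \<notin> writes visit \<longrightarrow> s' z = s z"
    then obtain j where j: "j \<le> 2 ^ \<sigma>" "k = 2 ^ \<sigma> - j" "s' rP = p + j"
      "s' rACC = s rACC \<otimes> finprod G v (A (p + j))" by blast
    have s': "s' rS = stride" "s' rZERO = 0" "s' rONE = 1" "s' rLV = i" "s' rPE = p + 2 ^ \<sigma>"
      "s' rX = s rX" "s' rY = s rY" using fr s by (simp_all add: writes_visit)
    have lt: "j < 2 ^ \<sigma>" using c j s' by simp
    have "run visit s' (42 * jmax + 22) (\<lambda>s''. s'' rP = Suc (p + j) \<and>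
       s'' rACC = (if el (lev i) (p + j) < s' rX \<and> yr (el (lev i) (p + j)) < s' rY
         then s' rACC \<otimes> v (el (lev i) (p + j)) else s' rACC))"
      by (rule run_visit) (use s s' j lt fp_closed[OF A] in auto)
    then show "run visit s' (42 * jmax + 22) (\<lambda>s''. \<exists>k'<k. \<exists>j\<le>2 ^ \<sigma>. k' = 2 ^ \<sigma> - j \<and>
        s'' rP = p + j \<and> s'' rACC = s rACC \<otimes> finprod G v (A (p + j)))"
      by (rule ev_mono)
        (use step[of "p + j"] s(8) s' j lt in \<open>auto intro!: exI[of _ "Suc j"]\<close>)
  next
    fix k s'
    assume "\<exists>j\<le>2 ^ \<sigma>. k = 2 ^ \<sigma> - j \<and> s' rP = p + j \<and> s' rACC = s rACC \<otimes> finprod G v (A (p + j))"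
      and c: "\<not> s' rP < s' rPE" and fr: "\<forall>z. z \<notin> writes visit \<longrightarrow> s' z = s z"
    then obtain j where j: "j \<le> 2 ^ \<sigma>" "s' rP = p + j"
      "s' rACC = s rACC \<otimes> finprod G v (A (p + j))" by blast
    have "s' rPE = p + 2 ^ \<sigma>" using fr s by (simp add: writes_visit)
    then have "j = 2 ^ \<sigma>" using c j by simp
    then show "s' rACC = s rACC \<otimes> finprod G v
     {e. e < 2 ^ K \<and> p \<le> pos (lev i) e \<and> pos (lev i) e < p + 2 ^ \<sigma> \<and> e < s rX \<and> yr e < s rY}"
      using j by (simp add: A_def)
  qed simp
qed

lemma cell_samples:
  assumes i: "i < height" and k: "k < 2 ^ (K - \<sigma>)"
  shows "cell (i * 2 ^ (K - \<sigma>) + k) 9 mod 2 ^ w = prefix i k"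
    and "cell (i * 2 ^ (K - \<sigma>) + k) 10 mod 2 ^ w = yr (el (lev i) (k * 2 ^ \<sigma>))"
    and "k * 2 ^ \<sigma> + 2 ^ \<sigma> \<le> 2 ^ K"
proof -
  have "Suc k * 2 ^ \<sigma> \<le> 2 ^ (K - \<sigma>) * 2 ^ \<sigma>" using k by (intro mult_le_mono1) simp
  then show le: "k * 2 ^ \<sigma> + 2 ^ \<sigma> \<le> 2 ^ K" by (simp add: powR mult.commute)
  have "k * 2 ^ \<sigma> < 2 ^ K" using le by (rule order_less_le_trans[rotated]) simp
  then have "el (lev i) (k * 2 ^ \<sigma>) < 2 ^ K" by (rule el_less[OF lev_pos lev_dvd[OF i]])
  then show "cell (i * 2 ^ (K - \<sigma>) + k) 10 mod 2 ^ w = yr (el (lev i) (k * 2 ^ \<sigma>))"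
    using less_word[OF yr] k by (simp add: cell_def)
  have "prefix i k \<in> carrier G" unfolding prefix_def by (rule fp_closed) auto
  then show "cell (i * 2 ^ (K - \<sigma>) + k) 9 mod 2 ^ w = prefix i k"
    using carrier_word k by (simp add: cell_def)
qed

lemma two_word: "(2 :: nat) mod 2 ^ w = 2"
  using K power_increasing[of 2 w "2 :: nat"] by simp

text \<open>The invariant concerns only the two ends of the remaining interval, and the original
  ends act as sentinels that are never compared. The outcome has the form of the hypotheses
  \<open>lo\<close> and \<open>hi\<close> of \<open>node_split\<close>.\<close>

lemma run_bsearch:
  fixes i :: nat
  defines "ys \<equiv> \<lambda>k. yr (el (lev i) (k * 2 ^ \<sigma>))"
  assumes s: "s rS = stride" "s rONE = 1" "i < height" "s rT = 2 ^ u" "s rG = i * 2 ^ (K - \<sigma>) + k"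
    "k + 2 ^ u \<le> 2 ^ (K - \<sigma>)"
  shows "run bsearch s (u * 12 + 2) (\<lambda>s'. \<exists>k'. k \<le> k' \<and> k' < k + 2 ^ u \<and> s' rG = i * 2 ^ (K - \<sigma>) + k' \<and>
     (k' = k \<or> ys k' < s rY) \<and> (k' + 1 = k + 2 ^ u \<or> s rY \<le> ys (k' + 1)))"
  unfolding bsearch_def
proof (rule ev_While[where T = 10 and n = u and
      I = "\<lambda>j s'. \<exists>k'. s' rT = 2 ^ j \<and> k \<le> k' \<and> k' + 2 ^ j \<le> k + 2 ^ u \<and> s' rG = i * 2 ^ (K - \<sigma>) + k' \<and>
        (k' = k \<or> ys k' < s rY) \<and> (k' + 2 ^ j = k + 2 ^ u \<or> s rY \<le> ys (k' + 2 ^ j))"])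
  show "\<exists>k'. s rT = 2 ^ u \<and> k \<le> k' \<and> k' + 2 ^ u \<le> k + 2 ^ u \<and> s rG = i * 2 ^ (K - \<sigma>) + k' \<and>
        (k' = k \<or> ys k' < s rY) \<and> (k' + 2 ^ u = k + 2 ^ u \<or> s rY \<le> ys (k' + 2 ^ u))"
    using s by auto
next
  let ?body = "Blk ([Const rC 2, Arith Div rT rT rC, Arith Add rA rG rT] @ ld rB rA 10) ;;
      IfLess rB rY (Blk [Move rG rA])"
  fix j s'
  assume "\<exists>k'. s' rT = 2 ^ j \<and> k \<le> k' \<and> k' + 2 ^ j \<le> k + 2 ^ u \<and> s' rG = i * 2 ^ (K - \<sigma>) + k' \<and>
        (k' = k \<or> ys k' < s rY) \<and> (k' + 2 ^ j = k + 2 ^ u \<or> s rY \<le> ys (k' + 2 ^ j))"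
    and c: "s' rONE < s' rT" and fr: "\<forall>z. z \<notin> writes ?body \<longrightarrow> s' z = s z"
  then obtain k' where k': "s' rT = 2 ^ j" "k \<le> k'" "k' + 2 ^ j \<le> k + 2 ^ u" "s' rG = i * 2 ^ (K - \<sigma>) + k'"
    "k' = k \<or> ys k' < s rY" "k' + 2 ^ j = k + 2 ^ u \<or> s rY \<le> ys (k' + 2 ^ j)" by blast
  have s': "s' rS = stride" "s' rONE = 1" "s' rY = s rY"
    using fr s by (simp_all add: writes_lemmas del: writes.simps(1))
  obtain j' where j': "j = Suc j'" using c k' s' by (cases j) auto
  have lt: "k' + 2 ^ j' < 2 ^ (K - \<sigma>)" using k'(3) s(6) zero_less_power[of "2 :: nat" j'] unfolding j' power_Suc by linarith
  note row = level_row[OF s(3) lt]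
  have pw: "2 ^ j' < (2::nat) ^ w" "i * 2 ^ (K - \<sigma>) + k' + 2 ^ j' < 2 ^ w"
    using less_word[OF row] by linarith+
  let ?s = "fold (isem w G m) ([Const rC 2, Arith Div rT rT rC, Arith Add rA rG rT] @ ld rB rA 10) s'"
  have t: "?s rT = 2 ^ j'" "?s rA = i * 2 ^ (K - \<sigma>) + k' + 2 ^ j'" "?s rB = ys (k' + 2 ^ j')"
    "?s rY = s rY" "?s rG = i * 2 ^ (K - \<sigma>) + k'"
    using k' s' j' row pw two_word cell_samples(2)[OF s(3) lt]
    by (simp_all add: fold_ld ys_def add.assoc)
  define s2 where "s2 = ?s"
  show "run ?body s' 10 (\<lambda>s''. \<exists>j''<j. \<exists>k'. s'' rT = 2 ^ j'' \<and> k \<le> k' \<and> k' + 2 ^ j'' \<le> k + 2 ^ u \<and>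
      s'' rG = i * 2 ^ (K - \<sigma>) + k' \<and>
        (k' = k \<or> ys k' < s rY) \<and> (k' + 2 ^ j'' = k + 2 ^ u \<or> s rY \<le> ys (k' + 2 ^ j'')))"
  proof (rule ev_Blk_Seq[where T = 3])
    show "run (IfLess rB rY (Blk [Move rG rA])) ?s 3 (\<lambda>s''. \<exists>j''<j. \<exists>k'. s'' rT = 2 ^ j'' \<and> k \<le> k' \<and>
      k' + 2 ^ j'' \<le> k + 2 ^ u \<and> s'' rG = i * 2 ^ (K - \<sigma>) + k' \<and>
        (k' = k \<or> ys k' < s rY) \<and> (k' + 2 ^ j'' = k + 2 ^ u \<or> s rY \<le> ys (k' + 2 ^ j'')))"
      unfolding s2_def[symmetric]
    proof (rule ev_If[where T = 1])
      assume "s2 rB < s2 rY"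
      then have "ys (k' + 2 ^ j') < s rY" using t by (simp only: s2_def)
      then show "run (Blk [Move rG rA]) s2 1 (\<lambda>s''. \<exists>j''<j. \<exists>k'. s'' rT = 2 ^ j'' \<and> k \<le> k' \<and>
          k' + 2 ^ j'' \<le> k + 2 ^ u \<and> s'' rG = i * 2 ^ (K - \<sigma>) + k' \<and>
          (k' = k \<or> ys k' < s rY) \<and> (k' + 2 ^ j'' = k + 2 ^ u \<or> s rY \<le> ys (k' + 2 ^ j'')))"
        using t[folded s2_def] k' j'
        by (intro ev_Blk) (auto intro!: exI[of _ j'] exI[of _ "k' + 2 ^ j'"] simp: mult_2 add.assoc)
    next
      assume "\<not> s2 rB < s2 rY"
      then have "s rY \<le> ys (k' + 2 ^ j')" using t by (simp only: s2_def not_less)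
      then show "\<exists>j''<j. \<exists>k'. s2 rT = 2 ^ j'' \<and> k \<le> k' \<and>
          k' + 2 ^ j'' \<le> k + 2 ^ u \<and> s2 rG = i * 2 ^ (K - \<sigma>) + k' \<and>
          (k' = k \<or> ys k' < s rY) \<and> (k' + 2 ^ j'' = k + 2 ^ u \<or> s rY \<le> ys (k' + 2 ^ j''))"
        using t[folded s2_def] k' j' by (intro exI[of _ j'] exI[of _ k'] conjI) auto
    qed simp
  qed (auto simp: ball_Un)
next
  fix j s'
  assume "\<exists>k'. s' rT = 2 ^ j \<and> k \<le> k' \<and> k' + 2 ^ j \<le> k + 2 ^ u \<and> s' rG = i * 2 ^ (K - \<sigma>) + k' \<and>
        (k' = k \<or> ys k' < s rY) \<and> (k' + 2 ^ j = k + 2 ^ u \<or> s rY \<le> ys (k' + 2 ^ j))"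
    and c: "\<not> s' rONE < s' rT"
    and fr: "\<forall>z. z \<notin> writes (Blk ([Const rC 2, Arith Div rT rT rC, Arith Add rA rG rT] @ ld rB rA 10) ;;
      IfLess rB rY (Blk [Move rG rA])) \<longrightarrow> s' z = s z"
  then obtain k' where k': "s' rT = 2 ^ j" "k \<le> k'" "k' + 2 ^ j \<le> k + 2 ^ u" "s' rG = i * 2 ^ (K - \<sigma>) + k'"
    "k' = k \<or> ys k' < s rY" "k' + 2 ^ j = k + 2 ^ u \<or> s rY \<le> ys (k' + 2 ^ j)" by blast
  have "s' rONE = 1" using fr s by (simp add: writes_lemmas del: writes.simps(1))
  then have "j = 0" using c k'(1) one_less_power[of "2 :: nat" j] by (cases "j = 0") simp_all
  then show "\<exists>k'. k \<le> k' \<and> k' < k + 2 ^ u \<and> s' rG = i * 2 ^ (K - \<sigma>) + k' \<and>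
     (k' = k \<or> ys k' < s rY) \<and> (k' + 1 = k + 2 ^ u \<or> s rY \<le> ys (k' + 1))"
    using k' by (intro exI[of _ k']) auto
qed simp

text \<open>Blocks of 11 and 12 instructions, two loop exits of 2 each, at most \<open>K\<close>
  halvings of 12, and \<open>2 ^ \<sigma>\<close> visits.\<close>

definition node_cost :: nat where
  "node_cost = 27 + 12 * K + 2 ^ \<sigma> * (42 * jmax + 24)"

lemma run_node:
  assumes s: "s rS = stride" "s rZERO = 0" "s rONE = 1" "s rBLK = 2 ^ \<sigma>" "s rLV = i" "i < height"
    "s rN = Suc n" "s rACC \<in> carrier G" "Suc n * lev i \<le> 2 ^ K" "Suc n * lev i \<le> s rX \<or> i = 0"
  shows "run node s node_cost (\<lambda>s'. s' rN = n \<and>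
    s' rACC = s rACC \<otimes> finprod G v {e. e < 2 ^ K \<and> e div lev i = n \<and> e < s rX \<and> yr e < s rY})"
proof -
  note M = lev_pos lev_dvd[OF s(6)]
  define RS where "RS = (2 :: nat) ^ (K - \<sigma>)"
  let ?B = "(2 :: nat) ^ (i * d)"
  have lB: "lev i = ?B * 2 ^ \<sigma>" by (simp add: lev_def power_add)
  have "(n * ?B + ?B) * 2 ^ \<sigma> \<le> RS * 2 ^ \<sigma>"
    using s(9) by (simp add: powR RS_def lB algebra_simps)
  then have nB: "n * ?B + ?B \<le> RS" by simp
  then have nB': "n * ?B < RS" by (rule order_less_le_trans[rotated]) simp
  have iR: "i < 2 ^ K" using height_less s(6) by simp
  have row: "i * RS + k < 2 ^ K" if "k < RS" for k using level_row[OF s(6)] that by (simp add: RS_def)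
  have nlt: "Suc n < 2 ^ w"
  proof -
    have "Suc n * 1 \<le> Suc n * lev i" by (intro mult_le_mono2) (simp add: Suc_le_eq)
    from order_trans[OF this s(9)] have "Suc n \<le> 2 ^ K" by (simp only: mult_1_right)
    then show ?thesis using pow_K_less_w by linarith
  qed
  have b: "n * ?B < 2 ^ w" "n * ?B + i * RS < 2 ^ w" "(n + 2 ^ w) mod 2 ^ w = n"
    using less_word[OF row[OF nB']] nlt by (auto simp: add.commute)
  let ?blk3 = "ld rA rG 9 @ [GAdd rACC rACC rA] @ ld rA rLV 16 @
       [Arith Sub rP rG rA, Arith Mul rP rP rBLK, Arith Add rPE rP rBLK]"
  let ?Q = "\<lambda>s'. s' rN = n \<and>
    s' rACC = s rACC \<otimes> finprod G v {e. e < 2 ^ K \<and> e div lev i = n \<and> e < s rX \<and> yr e < s rY}"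
  let ?ys = "\<lambda>k. yr (el (lev i) (k * 2 ^ \<sigma>))"
  have rest: "run (Blk ?blk3 ;; scan) s2 (14 + 2 ^ \<sigma> * (42 * jmax + 24)) ?Q"
    if s2: "s2 rS = stride" "s2 rZERO = 0" "s2 rONE = 1" "s2 rBLK = 2 ^ \<sigma>" "s2 rLV = i" "s2 rN = n"
      "s2 rX = s rX" "s2 rY = s rY" "s2 rACC = s rACC" "s2 rG = i * RS + k"
    and k: "n * ?B \<le> k" "k < n * ?B + ?B" "k = n * ?B \<or> ?ys k < s rY"
      "k + 1 = n * ?B + ?B \<or> s rY \<le> ?ys (k + 1)" for s2 k
  proof -
    have kR: "k < RS" using k nB by simp
    note smp = cell_samples[OF s(6) kR[unfolded RS_def], folded RS_def]
    have pc: "prefix i k \<in> carrier G" unfolding prefix_def by (rule fp_closed) auto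
    have lt: "k * 2 ^ \<sigma> + 2 ^ \<sigma> < 2 ^ w"
      using smp(3) pow_K_less_w by linarith
    then have lt2: "k * 2 ^ \<sigma> < 2 ^ w" by simp
    have sub: "(i * RS + k + 2 ^ w - i * RS) mod 2 ^ w = k"
      using sub_word[of "i * RS" "i * RS + k"] less_word[OF row[OF kR]] by simp
    define s3 where "s3 = fold (isem w G m) ?blk3 s2"
    have s3: "s3 rS = stride" "s3 rZERO = 0" "s3 rONE = 1" "s3 rLV = i" "s3 rN = n"
      "s3 rX = s rX" "s3 rY = s rY" "s3 rACC = s rACC \<otimes> prefix i k" "s3 rP = k * 2 ^ \<sigma>"
      "s3 rPE = k * 2 ^ \<sigma> + 2 ^ \<sigma>"
      unfolding s3_def
      using s2 row[OF kR] iR smp(1) pc s(8) sub lt lt2 cell_desc(4)[OF s(6), folded RS_def]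
      by (simp_all add: fold_ld)
    let ?A = "{e. e < 2 ^ K \<and> e div lev i = k * 2 ^ \<sigma> div lev i \<and> pos (lev i) e < k * 2 ^ \<sigma>}"
    let ?C = "{e. e < 2 ^ K \<and> k * 2 ^ \<sigma> \<le> pos (lev i) e \<and> pos (lev i) e < k * 2 ^ \<sigma> + 2 ^ \<sigma> \<and>
      e < s rX \<and> yr e < s rY}"
    \<comment> \<open>A node of level \<open>i\<close> has \<open>2 ^ (i * d)\<close> samples; on
      level 0 this is one, which is the case \<open>M = s\<close> of
      \<open>node_split\<close>.\<close>
    have sp: "{e. e < 2 ^ K \<and> e div lev i = n \<and> e < s rX \<and> yr e < s rY} = ?A \<union> ?C"
      by (rule node_split[where B = ?B]) (use M lB s(9,10) k in \<open>auto simp: lev_0\<close>)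
    have "finprod G v (?A \<union> ?C) = finprod G v ?A \<otimes> finprod G v ?C" by (rule fp_union) auto
    then have fin: "s rACC \<otimes> prefix i k \<otimes> finprod G v ?C
        = s rACC \<otimes> finprod G v {e. e < 2 ^ K \<and> e div lev i = n \<and> e < s rX \<and> yr e < s rY}"
      unfolding sp prefix_def using s(8) fp_closed[of ?A] fp_closed[of ?C] by (simp add: m_assoc subset_eq)
    have "run scan s3 (2 ^ \<sigma> * (42 * jmax + 24) + 2) (\<lambda>s'. s' rACC = s3 rACC \<otimes> finprod G v
     {e. e < 2 ^ K \<and> k * 2 ^ \<sigma> \<le> pos (lev i) e \<and> pos (lev i) e < k * 2 ^ \<sigma> + 2 ^ \<sigma> \<and> e < s3 rX \<and> yr e < s3 rY})"
      by (rule run_scan) (use s3 s smp pc in auto)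
    from ev_frame[OF this] have "run scan s3 (2 ^ \<sigma> * (42 * jmax + 24) + 2) ?Q"
      by (rule ev_mono) (use s3 fin in \<open>auto simp: writes_scan\<close>)
    then show ?thesis
      by (intro ev_Blk_Seq[where T = "2 ^ \<sigma> * (42 * jmax + 24) + 2"])
        (auto simp: s3_def ball_Un)
  qed
  let ?blk1 = "[Arith Sub rN rN rONE] @ ld rT rLV 17 @ ld rA rLV 16 @
       [Arith Mul rG rN rT, Arith Add rG rG rA]"
  define s1 where "s1 = fold (isem w G m) ?blk1 s"
  have s1: "s1 rS = stride" "s1 rZERO = 0" "s1 rONE = 1" "s1 rBLK = 2 ^ \<sigma>" "s1 rLV = i" "s1 rN = n"
      "s1 rX = s rX" "s1 rY = s rY" "s1 rACC = s rACC" "s1 rT = ?B" "s1 rG = i * RS + n * ?B"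
    unfolding s1_def
    using s iR b cell_desc(4)[OF s(6), folded RS_def] cell_desc(5)[OF s(6)]
    by (simp_all add: fold_ld)
  have bs: "run bsearch s1 (i * d * 12 + 2) (\<lambda>s'. \<exists>k'. n * ?B \<le> k' \<and> k' < n * ?B + ?B \<and>
     s' rG = i * 2 ^ (K - \<sigma>) + k' \<and>
     (k' = n * ?B \<or> ?ys k' < s1 rY) \<and> (k' + 1 = n * ?B + ?B \<or> s1 rY \<le> ?ys (k' + 1)))"
    by (rule run_bsearch) (use s1 s(6) nB in \<open>auto simp: RS_def\<close>)
  have "run (bsearch ;; Blk ?blk3 ;; scan) s1 (12 * K + 16 + 2 ^ \<sigma> * (42 * jmax + 24)) ?Q"
  proof (rule ev_Seq[OF bs])
    fix s2
    assume "\<exists>k'. n * ?B \<le> k' \<and> k' < n * ?B + ?B \<and> s2 rG = i * 2 ^ (K - \<sigma>) + k' \<and>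
     (k' = n * ?B \<or> ?ys k' < s1 rY) \<and> (k' + 1 = n * ?B + ?B \<or> s1 rY \<le> ?ys (k' + 1))"
     and fr: "\<forall>x. x \<notin> writes bsearch \<longrightarrow> s2 x = s1 x"
    then obtain k where k: "n * ?B \<le> k" "k < n * ?B + ?B" "s2 rG = i * RS + k"
     "k = n * ?B \<or> ?ys k < s rY" "k + 1 = n * ?B + ?B \<or> s rY \<le> ?ys (k + 1)"
      unfolding RS_def s1 by blast
    show "run (Blk ?blk3 ;; scan) s2 (14 + 2 ^ \<sigma> * (42 * jmax + 24)) ?Q"
      by (rule rest[of s2 k, OF _ _ _ _ _ _ _ _ _ k(3,1,2,4,5)])
        (use fr s1 in \<open>simp_all add: writes_bsearch\<close>)
  next
    show "i * d * 12 + 2 + (14 + 2 ^ \<sigma> * (42 * jmax + 24)) \<le> 12 * K + 16 + 2 ^ \<sigma> * (42 * jmax + 24)"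
      using level_exp[OF s(6)] by simp
  qed
  then show ?thesis
    unfolding node_def s1_def
    by (rule ev_Blk_Seq[rotated]) (auto simp: node_cost_def ball_Un)
qed

text \<open>Between nodes, \<open>rACC\<close> is the sum over the strip starting at
  \<open>rN * lev i\<close>: empty at first, the whole quadrant once \<open>rN\<close> is 0.\<close>

definition strip :: "nat \<Rightarrow> nat \<Rightarrow> nat \<Rightarrow> nat set" where
  "strip l X Y = {e. l \<le> e \<and> e < X \<and> yr e < Y}"

lemma strip_subset: "X < 2 ^ K \<Longrightarrow> strip l X Y \<subseteq> {..<2 ^ K}"
  by (auto simp: strip_def)

lemma strip_node:
  assumes "0 < M" "X < 2 ^ K"
  shows "strip (n * M) X Y = strip (Suc n * M) X Y \<union> {e. e < 2 ^ K \<and> e div M = n \<and> e < X \<and> yr e < Y}"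
    and "strip (Suc n * M) X Y \<inter> {e. e < 2 ^ K \<and> e div M = n \<and> e < X \<and> yr e < Y} = {}"
proof -
  have n: "e div M = n \<longleftrightarrow> n * M \<le> e \<and> e < Suc n * M" for e
  proof -
    have "n * M \<le> e \<longleftrightarrow> n \<le> e div M" "e < Suc n * M \<longleftrightarrow> e div M < Suc n"
      using assms(1) by (simp_all only: less_eq_div_iff_mult_less_eq div_less_iff_less_mult)
    then show ?thesis by auto
  qed
  show "strip (n * M) X Y = strip (Suc n * M) X Y \<union> {e. e < 2 ^ K \<and> e div M = n \<and> e < X \<and> yr e < Y}"
    unfolding n strip_def using assms(2) by auto
  show "strip (Suc n * M) X Y \<inter> {e. e < 2 ^ K \<and> e div M = n \<and> e < X \<and> yr e < Y} = {}"
    unfolding n strip_def by auto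
qed

definition level_cost :: nat where
  "level_cost = 6 + 2 ^ d * (node_cost + 2)"

lemma run_level:
  assumes s: "s rS = stride" "s rZERO = 0" "s rONE = 1" "s rBLK = 2 ^ \<sigma>" "s rFAN = 2 ^ d"
    "s rLV = i" "i < height" "s rX < 2 ^ K" "s rZ = s rX div lev i" "s rN = s rZ \<or> i = 0 \<and> s rN = Suc (s rZ)"
    "s rACC = finprod G v (strip (s rN * lev i) (s rX) (s rY))"
  shows "run level s level_cost (\<lambda>s'. s' rLV = Suc i \<and> s' rZ = s rX div lev (Suc i) \<and> s' rN = s' rZ \<and>
    s' rACC = finprod G v (strip (s' rN * lev (Suc i)) (s rX) (s rY)))"
proof -
  have lS: "lev (Suc i) = lev i * 2 ^ d" by (simp add: lev_def power_add)
  define Z where "Z = s rX div lev i"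
  define lo where "lo = Z div 2 ^ d * 2 ^ d"
  have Z': "s rX div lev (Suc i) = Z div 2 ^ d" by (simp add: lS Z_def div_mult2_eq)
  have loZ: "lo \<le> Z" by (simp add: lo_def)
  have Zlo: "Z < lo + 2 ^ d" unfolding lo_def using dividend_less_div_times[of "2 ^ d" Z] by simp
  have ZX: "Z * lev i \<le> s rX" by (simp add: Z_def)
  have lo_w: "lo < 2 ^ w"
    using loZ s(8) less_word[of lo] div_le_dividend[of "s rX" "lev i"] by (simp add: Z_def)
  have i1: "Suc i mod 2 ^ w = Suc i"
  proof -
    have "Suc i < 2 ^ w" using height_less[OF s(7)] pow_K_less_w by linarith
    then show ?thesis by simp
  qed
  let ?inv = "\<lambda>k s'. \<exists>n. s' rN = n \<and> k = n - lo \<and> lo \<le> n \<and> n \<le> s rN \<and>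
    s' rACC = finprod G v (strip (n * lev i) (s rX) (s rY))"
  define s1 where "s1 = fold (isem w G m) [Arith Div rZ rZ rFAN, Arith Mul rLO rZ rFAN] s"
  have s1: "s1 rS = stride" "s1 rZERO = 0" "s1 rONE = 1" "s1 rBLK = 2 ^ \<sigma>" "s1 rLV = i" "s1 rX = s rX"
    "s1 rY = s rY" "s1 rZ = Z div 2 ^ d" "s1 rLO = lo" "s1 rN = s rN" "s1 rACC = s rACC"
    unfolding s1_def using s(1-9) lo_w by (simp_all add: lo_def Z_def)
  \<comment> \<open>The strict bound on \<open>Z\<close> absorbs the additional node of level
    0.\<close>
  have N: "lo \<le> s rN" "s rN - lo \<le> 2 ^ d"
    using s(9,10) loZ Zlo by (auto simp flip: Z_def)
  have loop: "run (WhileLess rLO rN node) s1 (2 ^ d * (node_cost + 2) + 2)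
    (\<lambda>s'. s' rN = lo \<and> s' rACC = finprod G v (strip (lo * lev i) (s rX) (s rY)))"
  proof (rule ev_While[where T = node_cost and n = "s rN - lo" and I = ?inv])
    show "?inv (s rN - lo) s1" using s1 s(11) N by auto
  next
    fix k s'
    assume "?inv k s'" and c: "s' rLO < s' rN" and fr: "\<forall>z. z \<notin> writes node \<longrightarrow> s' z = s1 z"
    then obtain n where n: "s' rN = n" "k = n - lo" "lo \<le> n" "n \<le> s rN"
      "s' rACC = finprod G v (strip (n * lev i) (s rX) (s rY))" by blast
    have s': "s' rS = stride" "s' rZERO = 0" "s' rONE = 1" "s' rBLK = 2 ^ \<sigma>" "s' rLV = i" "s' rX = s rX"
      "s' rY = s rY" "s' rLO = lo" using fr s1 by (simp_all add: writes_node)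
    obtain n' where n': "n = Suc n'" "lo \<le> n'" using c n s' by (cases n) auto
    have "Suc n' * lev i \<le> 2 ^ K \<and> (Suc n' * lev i \<le> s rX \<or> i = 0)"
    proof (cases "Suc n' \<le> Z")
      case True
      then have "Suc n' * lev i \<le> Z * lev i" by (rule mult_le_mono1)
      then show ?thesis using ZX s(8) by simp
    next
      case False
      \<comment> \<open>This is the node containing the boundary, visited on level 0 only; it may
        extend beyond \<open>rX\<close> but not beyond \<open>2 ^ K\<close>.\<close>
      then have i: "i = 0" "n' = Z" using n n' s(9,10) by (auto simp flip: Z_def)
      have "Z < 2 ^ (K - \<sigma>)"
        using s(8) by (simp add: Z_def i lev_0 less_mult_imp_div_less powR mult.commute)
      then have "Suc n' * lev i \<le> 2 ^ (K - \<sigma>) * lev i" unfolding i(2) by (intro mult_le_mono1) simp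
      then show ?thesis using i by (simp add: lev_0 powR mult.commute)
    qed
    then have R: "run node s' node_cost (\<lambda>s''. s'' rN = n' \<and> s'' rACC = s' rACC \<otimes>
        finprod G v {e. e < 2 ^ K \<and> e div lev i = n' \<and> e < s' rX \<and> yr e < s' rY})"
      by - (rule run_node; use s' s(7,8) n n' in \<open>auto intro!: fp_closed strip_subset\<close>)
    have acc: "s' rACC \<otimes> finprod G v {e. e < 2 ^ K \<and> e div lev i = n' \<and> e < s' rX \<and> yr e < s' rY}
        = finprod G v (strip (n' * lev i) (s rX) (s rY))"
      unfolding strip_node(1)[where M = "lev i" and n = n' and Y = "s rY", OF lev_pos s(8)] n(5) n'(1) s'
      by (rule fp_union[symmetric]) (use strip_node(2)[OF lev_pos s(8)] strip_subset s(8) in auto)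
    show "run node s' node_cost (\<lambda>s''. \<exists>k'<k. ?inv k' s'')"
      by (rule ev_mono[OF R[unfolded acc] order_refl]) (use n n' in \<open>simp add: Suc_diff_le\<close>)
  next
    fix k s'
    assume "?inv k s'" and c: "\<not> s' rLO < s' rN" and fr: "\<forall>z. z \<notin> writes node \<longrightarrow> s' z = s1 z"
    then obtain n where n: "s' rN = n" "lo \<le> n"
      "s' rACC = finprod G v (strip (n * lev i) (s rX) (s rY))" by blast
    have "s' rLO = lo" using fr s1 by (simp add: writes_node)
    then have "n = lo" using c n by simp
    then show "s' rN = lo \<and> s' rACC = finprod G v (strip (lo * lev i) (s rX) (s rY))"
      using n by simp
  next
    show "(s rN - lo) * (node_cost + 2) + 2 \<le> 2 ^ d * (node_cost + 2) + 2"
      by (intro add_mono mult_le_mono1 N(2) order_refl)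
  qed
  have eq: "lo * lev i = Z div 2 ^ d * lev (Suc i)" by (simp add: lo_def lS)
  have "run (WhileLess rLO rN node ;; Blk [Move rN rZ, Arith Add rLV rLV rONE]) s1
      (2 ^ d * (node_cost + 2) + 4) (\<lambda>s'. s' rLV = Suc i \<and> s' rZ = s rX div lev (Suc i) \<and> s' rN = s' rZ \<and>
    s' rACC = finprod G v (strip (s' rN * lev (Suc i)) (s rX) (s rY)))"
  proof (rule ev_Seq[OF loop, where T' = 2])
    fix s2
    assume a: "s2 rN = lo \<and> s2 rACC = finprod G v (strip (lo * lev i) (s rX) (s rY))"
      and fr: "\<forall>x. x \<notin> writes (WhileLess rLO rN node) \<longrightarrow> s2 x = s1 x"
    have "s2 rLV = i" "s2 rZ = Z div 2 ^ d" "s2 rONE = 1" using fr s1 by (simp_all add: writes_node)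
    then show "run (Blk [Move rN rZ, Arith Add rLV rLV rONE]) s2 2 (\<lambda>s'. s' rLV = Suc i \<and>
      s' rZ = s rX div lev (Suc i) \<and> s' rN = s' rZ \<and>
      s' rACC = finprod G v (strip (s' rN * lev (Suc i)) (s rX) (s rY)))"
      using a i1 by (intro ev_Blk) (simp_all add: Z' eq)
  qed simp
  then show ?thesis
    unfolding level_def s1_def by (rule ev_Blk_Seq[rotated]) (auto simp: level_cost_def)
qed

definition dominance_cost :: nat where
  "dominance_cost = 6 + height * (level_cost + 2)"

lemma run_dominance:
  assumes s: "s rS = stride" "s rZERO = 0" "s rONE = 1" "s rBLK = 2 ^ \<sigma>" "s rFAN = 2 ^ d" "s rX < 2 ^ K"
  shows "run dominance s dominance_cost (\<lambda>s'. s' rACC = finprod G v {e. e < s rX \<and> yr e < s rY})"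
proof -
  let ?blk = "[GZero rACC, Const rLV 0, Arith Div rZ rX rBLK, Arith Add rN rZ rONE]"
  define s1 where "s1 = fold (isem w G m) ?blk s"
  let ?inv = "\<lambda>k s'. \<exists>i\<le>height. k = height - i \<and> s' rLV = i \<and> s' rZ = s rX div lev i \<and>
      (s' rN = s' rZ \<or> i = 0 \<and> s' rN = Suc (s' rZ)) \<and>
      s' rACC = finprod G v (strip (s' rN * lev i) (s rX) (s rY))"
  have lt: "Suc (s rX div 2 ^ \<sigma>) < 2 ^ w"
    using s(6) div_le_dividend[of "s rX" "2 ^ \<sigma>"] pow_K_less_w by linarith
  have "s rX < Suc (s rX div 2 ^ \<sigma>) * 2 ^ \<sigma>"
    using dividend_less_div_times[of "2 ^ \<sigma>" "s rX"] by simp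
  then have emp: "strip (Suc (s rX div 2 ^ \<sigma>) * 2 ^ \<sigma>) (s rX) (s rY) = {}"
    unfolding strip_def by auto
  have s1: "s1 rS = stride" "s1 rZERO = 0" "s1 rONE = 1" "s1 rBLK = 2 ^ \<sigma>" "s1 rFAN = 2 ^ d" "s1 rX = s rX"
    "s1 rY = s rY" "s1 rLV = 0" "s1 rZ = s rX div 2 ^ \<sigma>" "s1 rN = Suc (s rX div 2 ^ \<sigma>)"
    "s1 rACC = \<one>"
    unfolding s1_def using s lt by simp_all
  have "run (WhileLess rZERO rN level) s1 (dominance_cost - 4) (\<lambda>s'. s' rACC = finprod G v {e. e < s rX \<and> yr e < s rY})"
  proof (rule ev_While[where T = level_cost and n = height and I = ?inv])
    show "?inv height s1" using s1 emp by (intro exI[of _ 0]) (simp add: lev_0)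
  next
    fix k s'
    assume "?inv k s'" and c: "s' rZERO < s' rN" and fr: "\<forall>z. z \<notin> writes level \<longrightarrow> s' z = s1 z"
    then obtain i where i: "i \<le> height" "k = height - i" "s' rLV = i" "s' rZ = s rX div lev i"
      "s' rN = s' rZ \<or> i = 0 \<and> s' rN = Suc (s' rZ)"
      "s' rACC = finprod G v (strip (s' rN * lev i) (s rX) (s rY))" by blast
    have s': "s' rS = stride" "s' rZERO = 0" "s' rONE = 1" "s' rBLK = 2 ^ \<sigma>" "s' rFAN = 2 ^ d" "s' rX = s rX"
      "s' rY = s rY" using fr s1 by (simp_all add: writes_level)
    \<comment> \<open>By \<open>lev_height\<close> the loop test would fail on that level, so
      \<open>height - i\<close> is a valid variant.\<close>
    have "i \<noteq> height"
    proof
      assume "i = height"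
      then have "s' rZ = 0" "i \<noteq> 0" using i(4) lev_height s(6) height_0 by auto
      then show False using c i(5) by simp
    qed
    then have lt: "i < height" using i(1) by simp
    have "run level s' level_cost (\<lambda>s''. s'' rLV = Suc i \<and> s'' rZ = s' rX div lev (Suc i) \<and> s'' rN = s'' rZ \<and>
      s'' rACC = finprod G v (strip (s'' rN * lev (Suc i)) (s' rX) (s' rY)))"
      by (rule run_level) (use s' i lt s(6) in auto)
    then show "run level s' level_cost (\<lambda>s''. \<exists>k'<k. ?inv k' s'')"
      by (rule ev_mono) (use s' i lt in \<open>auto intro!: exI[of _ "Suc i"]\<close>)
  next
    fix k s'
    assume "?inv k s'" and c: "\<not> s' rZERO < s' rN" and fr: "\<forall>z. z \<notin> writes level \<longrightarrow> s' z = s1 z"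
    then obtain i where i: "s' rACC = finprod G v (strip (s' rN * lev i) (s rX) (s rY))" by blast
    have "s' rZERO = 0" using fr s1 by (simp add: writes_level)
    then have "s' rN = 0" using c by simp
    then show "s' rACC = finprod G v {e. e < s rX \<and> yr e < s rY}" using i by (simp add: strip_def)
  qed (simp add: dominance_cost_def)
  then show ?thesis
    unfolding dominance_def s1_def by (rule ev_Blk_Seq[rotated]) (auto simp: dominance_cost_def)
qed

text \<open>The blocks around the four dominance sums have 16, 5, 10, 6 and 1 instructions, together
  38.\<close>

lemma run_query:
  assumes x: "1 \<le> x1" "x1 \<le> 2 ^ K" "x2 < 2 ^ K" "cx (x1 - 1) \<le> cx x2"
    and y: "1 \<le> y1" "y1 \<le> 2 ^ K" "y2 < 2 ^ K" "cy (y1 - 1) \<le> cy y2"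
  shows "run query (query_regs x1 x2 y1 y2) (4 * dominance_cost + 38) (\<lambda>s'. s' 0 =
    finprod G v {e. cx (x1 - 1) \<le> e \<and> e < cx x2 \<and> cy (y1 - 1) \<le> yr e \<and> yr e < cy y2})"
proof -
  define D where "D X Y = finprod G v {e. e < X \<and> yr e < Y}" for X Y
  have Dc: "D X Y \<in> carrier G" if "X < 2 ^ K" for X Y
    unfolding D_def using that by (intro fp_closed) auto
  have res: "D (cx x2) (cy y2) \<otimes> inv (D (cx (x1 - 1)) (cy y2)) \<otimes> inv (D (cx x2) (cy (y1 - 1)))
      \<otimes> D (cx (x1 - 1)) (cy (y1 - 1))
    = finprod G v {e. cx (x1 - 1) \<le> e \<and> e < cx x2 \<and> cy (y1 - 1) \<le> yr e \<and> yr e < cy y2}"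
    unfolding D_def using v counts(1)[of x2] x(4) y(4) by (intro finprod_rect) auto
  have st: "stride < 2 ^ w"
  proof -
    have "2 * stride \<le> 2 ^ K * stride" using K by (intro mult_le_mono1) (cases K; simp)
    then show ?thesis using size stride_gt[of 0] by linarith
  qed
  \<comment> \<open>Row 0 starts at address 0, so the parameters have fixed addresses and can be
    read before the row length is known.\<close>
  have mem: "m 0 = stride" "m (Suc 0) = 2 ^ \<sigma>"
    using cells[of 0 0] cells[of 0 1] stride_gt st K by (simp_all add: cell_def)
  have "m (0 * stride + 2) = cell 0 2 mod 2 ^ w" by (rule cells) (simp_all add: stride_def)
  then have mem2: "m 2 = 2 ^ d" using d by (simp add: cell_def del: add_2_eq_Suc')
  have small: "(2 :: nat) mod 2 ^ w = 2" "Suc 0 mod 2 ^ w = Suc 0"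
    using two_word K power_increasing[of 1 w "2 :: nat"] by auto
  have cc: "cell k 3 mod 2 ^ w = cx k" "cell k 4 mod 2 ^ w = cy k" for k
    using counts[of k] less_word by (simp_all add: cell_def)
  have sb: "(x1 + 2 ^ w - Suc 0) mod 2 ^ w = x1 - 1" "(y1 + 2 ^ w - Suc 0) mod 2 ^ w = y1 - 1"
    using sub_word[of 1 x1] sub_word[of 1 y1] x y pow_K_less_w by auto
  define ok where "ok s \<longleftrightarrow> s rS = stride \<and> s rZERO = 0 \<and> s rONE = 1 \<and> s rBLK = 2 ^ \<sigma> \<and> s rFAN = 2 ^ d \<and>
    s 0 = x1 - 1 \<and> s 1 = x2 \<and> s 2 = y1 - 1 \<and> s 3 = y2" for s :: "nat \<Rightarrow> nat"
  have dominance: "run dominance s dominance_cost (\<lambda>s'. ok s' \<and> s' rACC = D (s rX) (s rY) \<and> s' rRES = s rRES \<and> s' rY = s rY)"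
    if "ok s" "s rX < 2 ^ K" for s
  proof -
    have "run dominance s dominance_cost (\<lambda>s'. s' rACC = D (s rX) (s rY))"
      unfolding D_def by (rule run_dominance) (use that in \<open>auto simp: ok_def\<close>)
    from ev_frame[OF this] show ?thesis
      by (rule ev_mono) (use that in \<open>auto simp: ok_def writes_dominance\<close>)
  qed
  have k: "x1 - 1 < 2 ^ K" "y1 - 1 < 2 ^ K" using x y by auto
  let ?X = "cx x2" and ?X' = "cx (x1 - 1)" and ?Y = "cy y2" and ?Y' = "cy (y1 - 1)"
  have seg: "run (Blk is ;; dominance ;; c) s U Q"
    if "\<forall>i\<in>set is. dest i \<noteq> None" and f: "ok (fold (isem w G m) is s)" "fold (isem w G m) is s rX = X"
      "fold (isem w G m) is s rY = Y" "fold (isem w G m) is s rRES = a" and X: "X < 2 ^ K"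
      and "\<And>s'. ok s' \<Longrightarrow> s' rACC = D X Y \<Longrightarrow> s' rRES = a \<Longrightarrow> s' rY = Y \<Longrightarrow> run c s' T Q"
      and U: "length is + (dominance_cost + T) \<le> U" for "is" c s X Y a T U Q
    by (rule ev_Blk_Seq[OF that(1) ev_Seq[OF dominance[OF f(1)] _ order_refl] U]) (use that in auto)
  note cl = Dc counts
  show ?thesis
    unfolding query_def
  proof (rule seg[where X = ?X and Y = ?Y and a = 0 and T = "3 * dominance_cost + 22"])
    fix s assume s: "ok s" "s rACC = D ?X ?Y" "s rRES = 0" "s rY = ?Y"
    show "run (Blk ([Move rRES rACC] @ ld rX 0 3) ;; dominance ;;
       Blk ([GInv rACC rACC, GAdd rRES rRES rACC] @ ld rX 1 3 @ ld rY 2 4) ;; dominance ;;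
       Blk ([GInv rACC rACC, GAdd rRES rRES rACC] @ ld rX 0 3) ;; dominance ;;
       Blk [GAdd 0 rRES rACC]) s (3 * dominance_cost + 22) (\<lambda>s'. s' 0 =
      finprod G v {e. ?X' \<le> e \<and> e < ?X \<and> ?Y' \<le> yr e \<and> yr e < ?Y})"
    proof (rule seg[where X = ?X' and Y = ?Y and a = "D ?X ?Y" and T = "2 * dominance_cost + 17"])
      fix s assume s: "ok s" "s rACC = D ?X' ?Y" "s rRES = D ?X ?Y" "s rY = ?Y"
      show "run (Blk ([GInv rACC rACC, GAdd rRES rRES rACC] @ ld rX 1 3 @ ld rY 2 4) ;; dominance ;;
         Blk ([GInv rACC rACC, GAdd rRES rRES rACC] @ ld rX 0 3) ;; dominance ;;
         Blk [GAdd 0 rRES rACC]) s (2 * dominance_cost + 17) (\<lambda>s'. s' 0 =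
        finprod G v {e. ?X' \<le> e \<and> e < ?X \<and> ?Y' \<le> yr e \<and> yr e < ?Y})"
      proof (rule seg[where X = ?X and Y = ?Y' and a = "D ?X ?Y \<otimes> inv (D ?X' ?Y)" and T = "dominance_cost + 7"])
        fix s assume s: "ok s" "s rACC = D ?X ?Y'" "s rRES = D ?X ?Y \<otimes> inv (D ?X' ?Y)" "s rY = ?Y'"
        show "run (Blk ([GInv rACC rACC, GAdd rRES rRES rACC] @ ld rX 0 3) ;; dominance ;;
           Blk [GAdd 0 rRES rACC]) s (dominance_cost + 7) (\<lambda>s'. s' 0 =
          finprod G v {e. ?X' \<le> e \<and> e < ?X \<and> ?Y' \<le> yr e \<and> yr e < ?Y})"
        proof (rule seg[where X = ?X' and Y = ?Y' and T = 1 and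
              a = "D ?X ?Y \<otimes> inv (D ?X' ?Y) \<otimes> inv (D ?X ?Y')"])
          fix s assume s: "ok s" "s rACC = D ?X' ?Y'"
            "s rRES = D ?X ?Y \<otimes> inv (D ?X' ?Y) \<otimes> inv (D ?X ?Y')" "s rY = ?Y'"
          show "run (Blk [GAdd 0 rRES rACC]) s 1 (\<lambda>s'. s' 0 =
            finprod G v {e. ?X' \<le> e \<and> e < ?X \<and> ?Y' \<le> yr e \<and> yr e < ?Y})"
            by (intro ev_Blk) (use s cl res in simp_all)
        qed (use s k cc cl in \<open>simp_all add: ok_def fold_ld ball_Un\<close>)
      qed (use s x y k cc cl in \<open>simp_all add: ok_def fold_ld ball_Un\<close>)
    qed (use s k cc cl in \<open>simp_all add: ok_def fold_ld ball_Un\<close>)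
  qed (use x y k mem mem2 small cc sb cl in \<open>simp_all add: ok_def fold_ld query_regs_def ball_Un\<close>)
qed

end

section \<open>Rank space and resource bounds\<close>

context comm_group
begin

text \<open>Points may share coordinates, so ties are broken by the other coordinate.
  \<open>cx k\<close> counts the points with x at most \<open>k\<close> and is thus the first rank
  beyond them. The padding ranks from \<open>r\<close> on carry the neutral element and are never
  below any \<open>cx k\<close>.\<close>

lemma rank_space:
  assumes P: "P \<subseteq> {1..r} \<times> {1..r}" "card P = r" "v \<in> P \<rightarrow> carrier G" and R: "r \<le> R"
  shows "\<exists>yr v' cx cy. inj_on yr {..<R} \<and> (\<forall>e<R. yr e < R) \<and> v' \<in> {..<R} \<rightarrow> carrier G \<and>
    (\<forall>k. cx k \<le> r) \<and> (\<forall>k. cy k \<le> r) \<and> mono cx \<and> mono cy \<and>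
    (\<forall>x1 x2 y1 y2. 1 \<le> x1 \<longrightarrow> 1 \<le> y1 \<longrightarrow>
      finprod G v' {e. cx (x1 - 1) \<le> e \<and> e < cx x2 \<and> cy (y1 - 1) \<le> yr e \<and> yr e < cy y2}
      = finprod G v (P \<inter> {x1..x2} \<times> {y1..y2}))"
proof -
  have fin: "finite P" using P(1) finite_subset by blast
  \<comment> \<open>Coordinates are at most \<open>r\<close>, so the factor \<open>r + 1\<close>
    makes the keys lexicographic.\<close>
  define kx where "kx = (\<lambda>p :: nat \<times> nat. fst p * (r + 1) + snd p)"
  define ky where "ky = (\<lambda>p :: nat \<times> nat. snd p * (r + 1) + fst p)"
  have lex: "a * (r + 1) + b < a' * (r + 1) + b'" if "a < a'" "b \<le> r" for a a' b b'
  proof -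
    have "Suc a * (r + 1) \<le> a' * (r + 1)" using that(1) by (intro mult_le_mono1) simp
    then show ?thesis using that(2) by simp
  qed
  have le: "fst p \<le> r" "snd p \<le> r" if "p \<in> P" for p using that P(1) by auto
  have kx: "kx p < kx p'" if "fst p < fst p'" "p \<in> P" for p p'
    unfolding kx_def using lex that le by blast
  have ky: "ky p < ky p'" if "snd p < snd p'" "p \<in> P" for p p'
    unfolding ky_def using lex that le by blast
  have injx: "inj_on kx P"
  proof (rule inj_onI)
    fix p p' assume p: "p \<in> P" "p' \<in> P" "kx p = kx p'"
    then have "fst p = fst p'" using kx[of p p'] kx[of p' p] by (metis less_irrefl linorder_neqE_nat)
    then show "p = p'" using p(3) by (simp add: kx_def prod_eq_iff)
  qed
  have injy: "inj_on ky P"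
  proof (rule inj_onI)
    fix p p' assume p: "p \<in> P" "p' \<in> P" "ky p = ky p'"
    then have "snd p = snd p'" using ky[of p p'] ky[of p' p] by (metis less_irrefl linorder_neqE_nat)
    then show "p = p'" using p(3) by (simp add: ky_def prod_eq_iff)
  qed
  define rx where "rx = (\<lambda>p. card {p' \<in> P. kx p' < kx p})"
  define ry where "ry = (\<lambda>p. card {p' \<in> P. ky p' < ky p})"
  have bx: "bij_betw rx P {..<r}" using card_keys_bij[OF fin injx] by (simp add: rx_def P(2))
  have by': "bij_betw ry P {..<r}" using card_keys_bij[OF fin injy] by (simp add: ry_def P(2))
  define pt where "pt = inv_into P rx"
  have bpt: "bij_betw pt {..<r} P" unfolding pt_def by (rule bij_betw_inv_into[OF bx])
  have pt: "pt (rx p) = p" if "p \<in> P" for p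
    unfolding pt_def using bij_betw_inv_into_left[OF bx that] .
  have ptP: "pt e \<in> P" if "e < r" for e using bij_betwE[OF bpt] that by simp
  have rpt: "rx (pt e) = e" if "e < r" for e
    unfolding pt_def using bij_betw_inv_into_right[OF bx] that by simp
  define yr where "yr e = (if e < r then ry (pt e) else e)" for e
  define v' where "v' e = (if e < r then v (pt e) else \<one>)" for e
  define cx where "cx k = card {p \<in> P. fst p \<le> k}" for k
  define cy where "cy k = card {p \<in> P. snd p \<le> k}" for k
  have ryr: "ry (pt e) < r" if "e < r" for e using bij_betwE[OF by'] ptP[OF that] by simp
  have "inj_on yr {..<R}"
  proof (rule inj_onI)
    fix e e' assume e: "yr e = yr e'"
    have "inj_on (\<lambda>e. ry (pt e)) {..<r}"
      using bij_betw_imp_inj_on[OF bij_betw_trans[OF bpt by']] by (simp add: comp_def)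
    then show "e = e'" using e ryr[of e] ryr[of e'] inj_onD[of "\<lambda>e. ry (pt e)" "{..<r}" e e']
      by (auto simp: yr_def split: if_splits)
  qed
  moreover have "\<forall>e<R. yr e < R" using ryr R by (auto simp: yr_def intro: less_le_trans)
  moreover have "v' \<in> {..<R} \<rightarrow> carrier G" using P(3) ptP by (auto simp: v'_def Pi_iff)
  moreover have cr: "cx k \<le> r" "cy k \<le> r" for k
    using card_mono[OF fin, of "{p \<in> P. fst p \<le> k}"] card_mono[OF fin, of "{p \<in> P. snd p \<le> k}"]
    by (auto simp: cx_def cy_def P(2))
  moreover have "mono cx" unfolding mono_def cx_def using fin by (auto intro!: card_mono)
  moreover have "mono cy" unfolding mono_def cy_def using fin by (auto intro!: card_mono)
  moreover have "finprod G v' {e. cx (x1 - 1) \<le> e \<and> e < cx x2 \<and> cy (y1 - 1) \<le> yr e \<and> yr e < cy y2}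
      = finprod G v (P \<inter> {x1..x2} \<times> {y1..y2})" if "1 \<le> x1" "1 \<le> y1" for x1 x2 y1 y2
  proof -
    let ?Q = "P \<inter> {x1..x2} \<times> {y1..y2}"
    have cx: "rx p < cx k \<longleftrightarrow> fst p \<le> k" if "p \<in> P" for p k
      unfolding rx_def cx_def by (rule card_keys_less_iff[OF fin that]) (auto intro: kx)
    have cy: "ry p < cy k \<longleftrightarrow> snd p \<le> k" if "p \<in> P" for p k
      unfolding ry_def cy_def by (rule card_keys_less_iff[OF fin that]) (auto intro: ky)
    have rxr: "rx p < r" if "p \<in> P" for p using bij_betwE[OF bx] that by simp
    have in_iff: "cx (x1 - 1) \<le> rx p \<and> rx p < cx x2 \<and> cy (y1 - 1) \<le> yr (rx p) \<and> yr (rx p) < cy y2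
        \<longleftrightarrow> p \<in> ?Q" if p: "p \<in> P" for p
    proof -
      have "cx (x1 - 1) \<le> rx p \<longleftrightarrow> x1 \<le> fst p" "cy (y1 - 1) \<le> ry p \<longleftrightarrow> y1 \<le> snd p"
        using cx[OF p, of "x1 - 1"] cy[OF p, of "y1 - 1"] \<open>1 \<le> x1\<close> \<open>1 \<le> y1\<close> by linarith+
      then show ?thesis using cx[OF p] cy[OF p] p rxr[OF p] pt[OF p] by (cases p) (auto simp: yr_def)
    qed
    have "{e. cx (x1 - 1) \<le> e \<and> e < cx x2 \<and> cy (y1 - 1) \<le> yr e \<and> yr e < cy y2} = rx ` ?Q"
    proof (intro equalityI subsetI)
      fix e assume e: "e \<in> {e. cx (x1 - 1) \<le> e \<and> e < cx x2 \<and> cy (y1 - 1) \<le> yr e \<and> yr e < cy y2}"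
      then have "e < cx x2" by simp
      then have er: "e < r" using cr(1)[of x2] by simp
      then have "pt e \<in> ?Q" using in_iff[OF ptP[OF er]] e rpt[OF er] by simp
      then show "e \<in> rx ` ?Q" using rpt[OF er] by (metis imageI)
    next
      fix e assume "e \<in> rx ` ?Q"
      then obtain p where "p \<in> ?Q" "e = rx p" by blast
      then show "e \<in> {e. cx (x1 - 1) \<le> e \<and> e < cx x2 \<and> cy (y1 - 1) \<le> yr e \<and> yr e < cy y2}"
        using in_iff[of p] by simp
    qed
    moreover have "finprod G v' (rx ` ?Q) = finprod G (\<lambda>p. v' (rx p)) ?Q"
    proof (rule finprod_reindex)
      show "v' \<in> rx ` ?Q \<rightarrow> carrier G" using P(3) pt rxr by (auto simp: v'_def)
      show "inj_on rx ?Q" using bij_betw_imp_inj_on[OF bx] by (rule inj_on_subset) blast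
    qed
    moreover have "finprod G (\<lambda>p. v' (rx p)) ?Q = finprod G v ?Q"
      by (rule finprod_cong') (use P(3) pt rxr in \<open>auto simp: v'_def\<close>)
    ultimately show ?thesis by simp
  qed
  ultimately show ?thesis by blast
qed

end

section \<open>Space and time in terms of the parameters\<close>

context tree
begin

context
  fixes J :: nat
  assumes J: "0 < J" "\<sigma> < d * J"
begin

text \<open>The condition on \<open>J\<close> says that \<open>J\<close> digits in base
  \<open>2 ^ d\<close> suffice for all level numbers.\<close>

lemma level_lt_power: "i < height \<Longrightarrow> i < (2 ^ d) ^ J"
proof -
  assume "i < height"
  then have "i < 2 ^ \<sigma>" using height_le by simp
  also have "(2 :: nat) ^ \<sigma> \<le> 2 ^ (d * J)" using J by (intro power_increasing) auto
  finally show ?thesis by (simp add: power_mult)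
qed

text \<open>With \<open>?n\<close> jumping levels, the shares \<sigma> cost at most
  \<open>?n * d * J\<close> bits by the condition on \<open>J\<close>, and the shares
  \<open>2 * d * stp\<close> at most twice that by \<open>sum_stp_le\<close>. Since
  \<open>?n * d\<close> is at most \<open>K\<close>, the total is at most
  \<open>3 * J * K\<close>.\<close>

lemma stride_le: "stride \<le> 19 + 3 * J"
proof -
  let ?n = "(K - \<sigma>) div d"
  have "off height = (\<Sum>i=1..?n. bits i)"
    by (simp add: off_def height_def sum.lessThan_Suc_shift sum.atLeast1_atMost_eq bits_def[of 0]
        del: sum.lessThan_Suc)
  also have "\<dots> = (\<Sum>i=1..?n. \<sigma> + 2 * d * stp (2 ^ d) i)" by (rule sum.cong) (auto simp: bits_def)
  also have "\<dots> = ?n * \<sigma> + 2 * d * (\<Sum>i=1..?n. stp (2 ^ d) i)"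
    by (simp add: sum.distrib sum_distrib_left)
  also have "\<dots> \<le> ?n * (d * J) + 2 * d * (J * ?n)"
    using sum_stp_le[OF fan2 level_lt_power[of ?n]] J by (intro add_mono mult_le_mono) (simp_all add: height_def)
  also have "\<dots> = 3 * J * (?n * d)" by simp
  also have "\<dots> \<le> 3 * J * K" using order_trans[OF times_div_less_eq_dividend[of d "K - \<sigma>"] diff_le_self]
    by (intro mult_le_mono2) (simp only: mult.commute)
  finally have "off height div K \<le> 3 * J * K div K" by (rule div_le_mono)
  then show ?thesis using K by (simp add: stride_def)
qed

end

text \<open>A cruder bound free of \<open>J\<close>: the table must be addressable for every
  \<epsilon>, but \<open>J\<close> grows without bound as \<epsilon> tends to 0 while the word size
  stays the same.\<close>

lemma stride_le': "stride \<le> 21 + 2 * K"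
proof -
  have "off height \<le> (\<Sum>i<height. 2 * K)" unfolding off_def by (intro sum_mono bits_le) simp
  also have "\<dots> \<le> 2 * (K + 1) * K" using mult_le_mono1[OF height_le(2), of "2 * K"] by (simp add: algebra_simps)
  finally have "off height div K \<le> 2 * (K + 1) * K div K" by (rule div_le_mono)
  then show ?thesis using K by (simp add: stride_def)
qed

lemma size_bound: "2 * K + 5 \<le> w \<Longrightarrow> 2 ^ K * stride \<le> 2 ^ w"
proof -
  assume w: "2 * K + 5 \<le> w"
  have "K < (2 :: nat) ^ K" by (rule less_exp)
  then have "stride \<le> 32 * 2 ^ K" using stride_le' by linarith
  then have "2 ^ K * stride \<le> 2 ^ K * (32 * 2 ^ K)" by (rule mult_le_mono2)
  also have "\<dots> = (2 :: nat) ^ (K + (5 + K))" by (simp only: power_add) simp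
  also have "\<dots> \<le> 2 ^ w" using w by (intro power_increasing) auto
  finally show ?thesis .
qed

end

context loaded
begin

text \<open>The constants accumulate as 66 = 42 + 24, 105 = 27 + 12 + 66, 113 = 6 + 105 + 2, 115 =
  113 + 2 and 522 = 4 * (6 + 115) + 38.\<close>

lemma cost_le:
  assumes J: "0 < J" "\<sigma> < d * J"
  shows "4 * dominance_cost + 38 \<le> 522 * ((2 ^ \<sigma>)\<^sup>2 * J * (2 ^ d)\<^sup>2)"
proof -
  define s where "s = (2 :: nat) ^ \<sigma>"
  define q where "q = (2 :: nat) ^ d"
  have s: "1 \<le> s" "K \<le> s" "height \<le> s" using K(3) height_le by (simp_all add: s_def)
  have q: "1 \<le> q" by (simp add: q_def)
  have "jmax \<le> J * (q - 1)"
    unfolding jmax_def q_def using height_0 dsum_le[OF fan2 level_lt_power[OF J]] by (intro Max.boundedI) auto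
  also have "\<dots> \<le> J * q" by simp
  finally have jm: "jmax \<le> J * q" .
  have Jq: "1 \<le> J * q" using J q by simp
  have sJq: "1 \<le> s * (J * q)" "s \<le> s * (J * q)" using s Jq by simp_all
  have "s * (42 * jmax + 24) \<le> s * (66 * (J * q))" using jm Jq by (intro mult_le_mono2) linarith
  then have "node_cost \<le> 105 * (s * (J * q))"
    using s sJq unfolding node_cost_def s_def[symmetric] by linarith
  then have "q * (node_cost + 2) \<le> q * (107 * (s * (J * q)))"
    using sJq by (intro mult_le_mono2) linarith
  moreover have t: "1 \<le> q * (s * (J * q))" using q sJq by simp
  ultimately have "level_cost \<le> 113 * (q * (s * (J * q)))"
    unfolding level_cost_def q_def[symmetric] by linarith
  then have "height * (level_cost + 2) \<le> s * (115 * (q * (s * (J * q))))"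
    using s t by (intro mult_le_mono) linarith+
  also have "\<dots> = 115 * (s * (q * (s * (J * q))))" by (rule mult.left_commute)
  finally have h: "height * (level_cost + 2) \<le> 115 * (s * (q * (s * (J * q))))" .
  have "4 * (6 + H) + 38 \<le> 522 * X" if "H \<le> 115 * X" "1 \<le> X" for H X :: nat
    using that by simp
  from this[OF h] have "4 * dominance_cost + 38 \<le> 522 * (s * (q * (s * (J * q))))"
    unfolding dominance_cost_def using s t by simp
  also have "s * (q * (s * (J * q))) = s\<^sup>2 * J * q\<^sup>2" by (simp add: power2_eq_square algebra_simps)
  finally show ?thesis by (simp add: s_def q_def)
qed

end

lemma range_sum_store:
  fixes G :: "nat monoid" and K \<sigma> d J w r N :: nat
  assumes G: "comm_group G" "carrier G = {..<N}" "N \<le> 2 ^ w"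
    and P: "P \<subseteq> {1..r} \<times> {1..r}" "card P = r" "v \<in> P \<rightarrow> carrier G"
    and K: "0 < K" "r < 2 ^ K" "\<sigma> \<le> K" "K < 2 ^ \<sigma>" "3 * K + 5 \<le> w"
    and d: "0 < d" "d < w" and J: "0 < J" "\<sigma> < d * J"
  shows "\<exists>D. length D \<le> 2 ^ K * (19 + 3 * J) \<and>
    answers_range_sums w G (code 0 query) r P v D (real (522 * ((2 ^ \<sigma>)\<^sup>2 * J * (2 ^ d)\<^sup>2)))"
proof -
  interpret comm_group G by (rule G(1))
  from rank_space[OF P, of "2 ^ K"] K(2)
  obtain yr v' cx cy where yr: "inj_on yr {..<2 ^ K}" "\<forall>e<2 ^ K. yr e < 2 ^ K"
    and v': "v' \<in> {..<2 ^ K} \<rightarrow> carrier G"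
    and cnt: "\<forall>k. cx k \<le> r" "\<forall>k. cy k \<le> r" "mono cx" "mono cy"
    and sum: "\<forall>x1 x2 y1 y2. 1 \<le> x1 \<longrightarrow> 1 \<le> y1 \<longrightarrow>
      finprod G v' {e. cx (x1 - 1) \<le> e \<and> e < cx x2 \<and> cy (y1 - 1) \<le> yr e \<and> yr e < cy y2}
      = finprod G v (P \<inter> {x1..x2} \<times> {y1..y2})"
    by auto
  interpret T: tree K yr G w \<sigma> d N v' cx cy
    by unfold_locales (use G K d yr v' cnt in \<open>auto intro: le_less_trans\<close>)
  \<comment> \<open>Truncation affects junk entries only; all entries that are read are below
    \<open>2 ^ w\<close>.\<close>
  define D where "D = map (\<lambda>a. T.cell (a div T.stride) (a mod T.stride) mod 2 ^ w) [0..<2 ^ K * T.stride]"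
  have len: "length D = 2 ^ K * T.stride" by (simp add: D_def)
  have sz: "2 ^ K * T.stride \<le> 2 ^ w" using T.size_bound K(5) by simp
  let ?T = "522 * ((2 ^ \<sigma>)\<^sup>2 * J * (2 ^ d)\<^sup>2)"
  have ans: "\<exists>t c. real t \<le> real ?T \<and>
           c = (step w G (code 0 query) ^^ t) \<lparr>pc = 0, regs = query_regs x1 x2 y1 y2, mem = m\<rparr> \<and>
           halted (code 0 query) c \<and>
           regs c 0 = range_sum G P v x1 x2 y1 y2 \<and>
           (\<forall>i < length D. mem c i = D ! i)"
    if q: "1 \<le> x1" "x1 \<le> x2" "x2 \<le> r" "1 \<le> y1" "y1 \<le> y2" "y2 \<le> r"
      and m: "\<forall>i < length D. m i = D ! i" for x1 x2 y1 y2 m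
  proof -
    interpret L: loaded K yr G w \<sigma> d N v' cx cy m
    proof
      show "2 ^ K * T.stride \<le> 2 ^ w" by (rule sz)
      fix k col :: nat assume k: "k < 2 ^ K" "col < T.stride"
      have "Suc k * T.stride \<le> 2 ^ K * T.stride" using k by (intro mult_le_mono1) simp
      then have lt: "k * T.stride + col < 2 ^ K * T.stride" using k(2) by simp
      then have "m (k * T.stride + col) = D ! (k * T.stride + col)" using m len by simp
      also have "\<dots> = T.cell k col mod 2 ^ w" using lt k(2) by (simp add: D_def)
      finally show "m (k * T.stride + col) = T.cell k col mod 2 ^ w" .
    qed
    have "L.run query (query_regs x1 x2 y1 y2) (4 * L.dominance_cost + 38) (\<lambda>s'. s' 0 =
      finprod G v' {e. cx (x1 - 1) \<le> e \<and> e < cx x2 \<and> cy (y1 - 1) \<le> yr e \<and> yr e < cy y2})"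
      by (rule L.run_query) (use q K(2) cnt(3,4) in \<open>auto simp: mono_def\<close>)
    then obtain t s' where t: "t \<le> 4 * L.dominance_cost + 38" "big w G m query (query_regs x1 x2 y1 y2) t s'"
      "s' 0 = finprod G v (P \<inter> {x1..x2} \<times> {y1..y2})"
      unfolding ev_def using sum q by auto
    have "t \<le> ?T" using t(1) L.cost_le[OF J] by (rule order_trans)
    moreover have "(step w G (code 0 query) ^^ t) \<lparr>pc = 0, regs = query_regs x1 x2 y1 y2, mem = m\<rparr>
        = \<lparr>pc = clen query, regs = s', mem = m\<rparr>"
      using big_runs[OF t(2), of "[]" "[]"] by simp
    ultimately show ?thesis using t(3) m
      by (intro exI[of _ t] exI[of _ "\<lparr>pc = clen query, regs = s', mem = m\<rparr>"])
        (simp add: halted_def range_sum_def del: of_nat_mult)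
  qed
  have "answers_range_sums w G (code 0 query) r P v D (real ?T)"
    unfolding answers_range_sums_def
    using sz ans by (auto simp: len simp del: of_nat_mult) (auto simp: D_def)
  moreover have "length D \<le> 2 ^ K * (19 + 3 * J)"
    unfolding len using T.stride_le[OF J] by (rule mult_le_mono2)
  ultimately show ?thesis by blast
qed

section \<open>Choice of the parameters\<close>

lemma lg_ge: "1 \<le> lg n" "log 2 (real n) \<le> lg n"
  by (simp_all add: lg_def)

lemma le_pow_lg: "lg n \<le> real w \<Longrightarrow> n \<le> 2 ^ w"
proof (cases "n = 0")
  case False
  assume "lg n \<le> real w"
  then have "log 2 (real n) \<le> real w" using lg_ge(2)[of n] by simp
  then have "real n \<le> 2 powr real w" using False by (subst (asm) log_le_iff) auto
  then have "real n \<le> real (2 ^ w)" by (simp add: powr_realpow)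
  then show ?thesis by (simp only: of_nat_le_iff)
qed simp

lemma answers_range_sums_mono:
  assumes "answers_range_sums w G prog r P v D T" "T \<le> T'"
  shows "answers_range_sums w G prog r P v D T'"
  unfolding answers_range_sums_def
proof (intro conjI allI impI)
  fix x1 x2 y1 y2 m
  assume q: "1 \<le> x1 \<and> x1 \<le> x2 \<and> x2 \<le> r \<and> 1 \<le> y1 \<and> y1 \<le> y2 \<and> y2 \<le> r \<and>
    (\<forall>a. m a < 2 ^ w) \<and> (\<forall>i < length D. m i = D ! i)"
  obtain t c where "real t \<le> T \<and>
           c = (step w G prog ^^ t) \<lparr>pc = 0, regs = query_regs x1 x2 y1 y2, mem = m\<rparr> \<and>
           halted prog c \<and>
           regs c 0 = range_sum G P v x1 x2 y1 y2 \<and>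
           (\<forall>i < length D. mem c i = D ! i)"
    using assms(1)[unfolded answers_range_sums_def, THEN conjunct2, THEN conjunct2, rule_format, OF q]
    by blast
  then show "\<exists>t c. real t \<le> T' \<and>
           c = (step w G prog ^^ t) \<lparr>pc = 0, regs = query_regs x1 x2 y1 y2, mem = m\<rparr> \<and>
           halted prog c \<and>
           regs c 0 = range_sum G P v x1 x2 y1 y2 \<and>
           (\<forall>i < length D. mem c i = D ! i)"
    using assms(2) by (intro exI[of _ t] exI[of _ c]) auto
qed (use assms(1) in \<open>simp_all add: answers_range_sums_def\<close>)

theorem theorem3:
  fixes eps0 :: real
  assumes "eps0 > 0"
  shows "\<exists>a\<ge>(1::real). \<forall>b\<ge>a. \<exists>Ct>(0::real). \<forall>k>(0::real). \<exists>Cs>(0::real).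
    \<forall>eps. 0 < eps \<and> eps \<le> eps0 \<longrightarrow>
      (\<exists>prog. \<forall>r N w (G :: nat monoid) P v.
         1 \<le> r \<and>
         comm_group G \<and> carrier G = {..<N} \<and>
         lg r \<le> k * lg N \<and>
         a * (lg r + lg N) \<le> real w \<and> real w \<le> b * (lg r + lg N) \<and>
         P \<subseteq> {1..r} \<times> {1..r} \<and> card P = r \<and> v \<in> P \<rightarrow> carrier G \<longrightarrow>
         (\<exists>D. real (length D * w) \<le> Cs * (1 / eps) * real r * lg N \<and>
              answers_range_sums w G prog r P v D (Ct * (1 / eps) * lg r powr (2 + eps))))"
proof -
  \<comment> \<open>The program is fixed, and of the two constants only that for space involves
    \<open>b\<close> and \<open>k\<close>.\<close>
  have main: "\<exists>D. real (length D * w) \<le> (2 * (22 * eps0 + 6) * b * (k + 1)) * (1 / eps) * real r * lg N \<and>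
      answers_range_sums w G (code 0 query) r P v D
        ((522 * 1024 * (2 + eps0)) * (1 / eps) * lg r powr (2 + eps))"
    if b: "8 \<le> b" and k: "0 < k" and eps: "0 < eps" "eps \<le> eps0" and r: "1 \<le> r"
      and G: "comm_group G" "carrier G = {..<N}" and rN: "lg r \<le> k * lg N"
      and w: "8 * (lg r + lg N) \<le> real w" "real w \<le> b * (lg r + lg N)"
      and P: "P \<subseteq> {1..r} \<times> {1..r}" "card P = r" "v \<in> P \<rightarrow> carrier G"
    for b k eps :: real and r N w :: nat and G :: "nat monoid" and P v
  proof -
    obtain n where n: "2 ^ n \<le> r" "r < 2 ^ (n + 1)" using ex_power_ivl1[of 2 r] r by auto
    define K where "K = n + 1"
    obtain l where l: "2 ^ l \<le> K" "K < 2 ^ (l + 1)" using ex_power_ivl1[of 2 K] K_def by auto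
    define \<sigma> where "\<sigma> = l + 1"
    define J where "J = nat \<lceil>2 / eps\<rceil>"
    \<comment> \<open>The least \<open>d\<close> with \<open>\<sigma> < d * J\<close>; thus
      \<open>2 ^ d\<close> is at most twice \<open>2 ^ \<sigma>\<close> to the power
      \<open>1 / J\<close>.\<close>
    define d where "d = \<sigma> div J + 1"
    define L where "L = lg r"
    have L: "1 \<le> L" "real n \<le> L" using lg_ge[of r] le_log2_of_power[OF n(1)] by (simp_all add: L_def)
    have KL: "real K \<le> 2 * L" using L by (simp add: K_def)
    have \<sigma>: "\<sigma> \<le> K" using l(1) less_exp[of l] unfolding \<sigma>_def by linarith
    have J0: "0 < 2 / eps" using eps by simp
    have J: "2 / eps \<le> real J" "real J \<le> 2 / eps + 1" "0 < J"
      using J0 unfolding J_def by (simp_all add: of_nat_ceiling less_imp_le)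
    have dJ: "\<sigma> < d * J" using dividend_less_times_div[OF J(3), of \<sigma>] by (simp add: d_def mult.commute)
    have w8: "8 * lg r + 8 * lg N \<le> real w" using w(1) by simp
    have "\<sigma> div J \<le> \<sigma>" by (rule div_le_dividend)
    \<comment> \<open>The origin of the factor 8: \<open>K\<close> is at most
      \<open>2 * lg r\<close> and \<open>lg N\<close> is at least 1, so \<open>w\<close> has room
      for windows and addresses.\<close>
    moreover have "4 * real K + 8 \<le> real w" using w8 KL lg_ge(1)[of N] unfolding L_def by linarith
    then have wK: "4 * K + 8 \<le> w" by linarith
    ultimately have dw: "d < w" using \<sigma> unfolding d_def by linarith
    have NW: "N \<le> 2 ^ w" using w8 lg_ge(1)[of r] lg_ge(1)[of N] by (intro le_pow_lg) linarith
    have "r < 2 ^ K" "K < 2 ^ \<sigma>" "0 < K" "0 < d" "3 * K + 5 \<le> w"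
      using n l wK by (simp_all add: K_def \<sigma>_def d_def)
    from range_sum_store[OF G NW P this(3,1) \<sigma> this(2,5,4) dw J(3) dJ]
    obtain D where D: "length D \<le> 2 ^ K * (19 + 3 * J)"
      "answers_range_sums w G (code 0 query) r P v D (real (522 * ((2 ^ \<sigma>)\<^sup>2 * J * (2 ^ d)\<^sup>2)))" by blast
    have sL: "2 ^ \<sigma> \<le> 4 * L"
    proof -
      have "2 ^ \<sigma> \<le> 2 * K" using l by (simp add: \<sigma>_def)
      then have "real (2 ^ \<sigma>) \<le> real (2 * K)" by (simp only: of_nat_le_iff)
      then show ?thesis using KL by simp
    qed
    have J2: "0 \<le> 2 / real J" "2 / real J \<le> 2" "2 / real J \<le> eps"
      using J eps by (simp_all add: field_simps)
    \<comment> \<open>Rounding \<open>d\<close> up costs the factor 4. From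
      \<open>2 / J \<le> 2\<close> the factor 4 in front of \<open>L\<close> contributes at most 16,
      and from \<open>2 / J \<le> eps\<close> the rest is at most \<open>L powr eps\<close>.\<close>
    have "((2::real) ^ d)\<^sup>2 = 4 * (2 powr real (\<sigma> div J))\<^sup>2"
      by (simp add: d_def powr_realpow power_mult_distrib)
    also have "\<dots> = 4 * 2 powr (2 * real (\<sigma> div J))"
      by (simp add: power2_eq_square flip: powr_add)
    also have "\<dots> \<le> 4 * 2 powr (2 * (real \<sigma> / real J))"
      using of_nat_div_le_of_nat[of \<sigma> J, where 'a = real] by (intro mult_left_mono powr_mono) auto
    also have "2 powr (2 * (real \<sigma> / real J)) = (2 ^ \<sigma>) powr (2 / real J)"
      by (simp add: powr_powr mult.commute flip: powr_realpow)
    also have "4 * (2 ^ \<sigma>) powr (2 / real J) \<le> 4 * (4 * L) powr (2 / real J)"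
      using sL J2 by (intro mult_left_mono powr_mono2) auto
    also have "(4 * L) powr (2 / real J) = 4 powr (2 / real J) * L powr (2 / real J)"
      using L by (simp add: powr_mult)
    also have "4 * (4 powr (2 / real J) * L powr (2 / real J)) \<le> 4 * (4 powr 2 * L powr eps)"
      using J2 L by (intro mult_left_mono mult_mono powr_mono) auto
    finally have q: "((2::real) ^ d)\<^sup>2 \<le> 64 * L powr eps" by simp
    have J': "real J \<le> (2 + eps0) / eps"
    proof -
      have "real J \<le> (2 + eps) / eps" using J(2) eps by (simp add: field_simps)
      also have "\<dots> \<le> (2 + eps0) / eps" using eps by (intro divide_right_mono) auto
      finally show ?thesis .
    qed
    have s2: "((2::real) ^ \<sigma>)\<^sup>2 \<le> 16 * L\<^sup>2"
      using power_mono[OF sL, of 2] by (simp add: power_mult_distrib)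
    have "real (522 * ((2 ^ \<sigma>)\<^sup>2 * J * (2 ^ d)\<^sup>2)) = 522 * (((2 ^ \<sigma>)\<^sup>2 * real J) * (2 ^ d)\<^sup>2)" by simp
    also have "\<dots> \<le> 522 * ((16 * L\<^sup>2 * ((2 + eps0) / eps)) * (64 * L powr eps))"
      using s2 J' q eps by (intro mult_left_mono mult_mono mult_nonneg_nonneg divide_nonneg_pos) auto
    also have "\<dots> = (522 * 1024 * (2 + eps0)) * (1 / eps) * (L\<^sup>2 * L powr eps)" by simp
    also have "L\<^sup>2 * L powr eps = L powr (2 + eps)" using L by (simp add: powr_add powr_numeral)
    finally have time: "real (522 * ((2 ^ \<sigma>)\<^sup>2 * J * (2 ^ d)\<^sup>2))
        \<le> (522 * 1024 * (2 + eps0)) * (1 / eps) * L powr (2 + eps)" .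
    have ans: "answers_range_sums w G (code 0 query) r P v D
        ((522 * 1024 * (2 + eps0)) * (1 / eps) * lg r powr (2 + eps))"
      by (rule answers_range_sums_mono[OF D(2) time[unfolded L_def]])
    \<comment> \<open>From \<open>J \<le> 2 / eps + 1\<close> the row length is at most
      \<open>22 + 6 / eps\<close>.\<close>
    have J19: "19 + 3 * real J \<le> (22 * eps0 + 6) / eps"
    proof -
      have "19 + 3 * real J \<le> (22 * eps + 6) / eps" using J(2) eps by (simp add: field_simps)
      also have "\<dots> \<le> (22 * eps0 + 6) / eps" using eps by (intro divide_right_mono) auto
      finally show ?thesis .
    qed
    have K2: "(2::real) ^ K \<le> 2 * real r"
    proof -
      have "2 ^ K \<le> 2 * r" using n by (simp add: K_def)
      then have "real (2 ^ K) \<le> real (2 * r)" by (simp only: of_nat_le_iff)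
      then show ?thesis by simp
    qed
    have "real (length D) \<le> real (2 ^ K * (19 + 3 * J))" using D(1) by (simp only: of_nat_le_iff)
    also have "\<dots> = 2 ^ K * (19 + 3 * real J)" by simp
    also have "\<dots> \<le> 2 * real r * ((22 * eps0 + 6) / eps)" by (rule mult_mono[OF K2 J19]) simp_all
    finally have len: "real (length D) \<le> 2 * real r * ((22 * eps0 + 6) / eps)" .
    \<comment> \<open>Here the bound on \<open>lg r / lg N\<close> turns a count of words into a
      multiple of the bits of a group element.\<close>
    have "real w \<le> b * ((k + 1) * lg N)"
    proof -
      have "b * (lg r + lg N) \<le> b * ((k + 1) * lg N)"
        using b rN by (intro mult_left_mono) (simp_all add: algebra_simps)
      then show ?thesis using w(2) by simp
    qed
    then have "real (length D) * real w \<le> (2 * real r * ((22 * eps0 + 6) / eps)) * (b * ((k + 1) * lg N))"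
      using len eps by (intro mult_mono) auto
    also have "\<dots> = (2 * (22 * eps0 + 6) * b * (k + 1)) * (1 / eps) * real r * lg N" by simp
    finally show ?thesis using ans by auto
  qed
  show ?thesis
  proof (rule exI[of _ 8], intro conjI allI impI)
    fix b :: real assume b: "8 \<le> b"
    show "\<exists>Ct>(0::real). \<forall>k>(0::real). \<exists>Cs>(0::real). \<forall>eps. 0 < eps \<and> eps \<le> eps0 \<longrightarrow>
      (\<exists>prog. \<forall>r N w (G :: nat monoid) P v.
         1 \<le> r \<and>
         comm_group G \<and> carrier G = {..<N} \<and>
         lg r \<le> k * lg N \<and>
         8 * (lg r + lg N) \<le> real w \<and> real w \<le> b * (lg r + lg N) \<and>
         P \<subseteq> {1..r} \<times> {1..r} \<and> card P = r \<and> v \<in> P \<rightarrow> carrier G \<longrightarrow>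
         (\<exists>D. real (length D * w) \<le> Cs * (1 / eps) * real r * lg N \<and>
              answers_range_sums w G prog r P v D (Ct * (1 / eps) * lg r powr (2 + eps))))"
    proof (rule exI[of _ "522 * 1024 * (2 + eps0)"], intro conjI allI impI)
      fix k :: real assume k: "0 < k"
      show "\<exists>Cs>(0::real). \<forall>eps. 0 < eps \<and> eps \<le> eps0 \<longrightarrow>
        (\<exists>prog. \<forall>r N w (G :: nat monoid) P v.
         1 \<le> r \<and>
         comm_group G \<and> carrier G = {..<N} \<and>
         lg r \<le> k * lg N \<and>
         8 * (lg r + lg N) \<le> real w \<and> real w \<le> b * (lg r + lg N) \<and>
         P \<subseteq> {1..r} \<times> {1..r} \<and> card P = r \<and> v \<in> P \<rightarrow> carrier G \<longrightarrow>
         (\<exists>D. real (length D * w) \<le> Cs * (1 / eps) * real r * lg N \<and>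
              answers_range_sums w G prog r P v D
                ((522 * 1024 * (2 + eps0)) * (1 / eps) * lg r powr (2 + eps))))"
      proof (rule exI[of _ "2 * (22 * eps0 + 6) * b * (k + 1)"], intro conjI allI impI)
        fix eps :: real assume eps: "0 < eps \<and> eps \<le> eps0"
        show "\<exists>prog. \<forall>r N w (G :: nat monoid) P v.
         1 \<le> r \<and>
         comm_group G \<and> carrier G = {..<N} \<and>
         lg r \<le> k * lg N \<and>
         8 * (lg r + lg N) \<le> real w \<and> real w \<le> b * (lg r + lg N) \<and>
         P \<subseteq> {1..r} \<times> {1..r} \<and> card P = r \<and> v \<in> P \<rightarrow> carrier G \<longrightarrow>
         (\<exists>D. real (length D * w) \<le> 2 * (22 * eps0 + 6) * b * (k + 1) * (1 / eps) * real r * lg N \<and>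
              answers_range_sums w G prog r P v D
                ((522 * 1024 * (2 + eps0)) * (1 / eps) * lg r powr (2 + eps)))"
          by (rule exI[of _ "code 0 query"], intro allI impI, elim conjE, rule main[OF b k]) (use eps in auto)
      qed (use assms b k in simp)
    qed (use assms in simp)
  qed simp
qed

end
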